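(* Let $s>0$ and let $f:\mathbb{R}^d\to[0,\infty)$ be a $1/s$-concave function with finite integral. Let $H$ be an affine hyperplane in $\mathbb{R}^d$ with half-spaces $H_+$ and $H_-$ (the two half-spaces bounded by $H$) such that $\lambda\int_{\mathbb{R}^d} f=\int_{H_+} f$ for some $\lambda\in(0,1)$. For $z\in\mathbb{R}^d$ write $f_{[z]}(x)=f(x+z)$. Then there exists $z\in H$ such that $$\int_{\mathbb{R}^d} f\;\int_{\mathbb{R}^d}\mathcal{L}_s\bigl(f_{[z]}\bigr)\le \frac{\kappa^2}{4\lambda(1-\lambda)},\qquad\text{where }\ \kappa=\int_{\mathbf{B}^d}\bigl(1-|x|^2\bigr)^{s/2}\,dx.$$
   Context: For $s>0$, a non-negative function $f$ on $\mathbb{R}^d$ is $1/s$-concave if $f^{1/s}$ is concave on its support $\operatorname{supp} f=\{x: f(x)>0\}$ (in particular, the support is convex). The $s$-polar transform of a non-negative function $f$ is $$\mathcal{L}_s f(y)=\inf_{\{x: f(x)>0\}}\frac{(1-\langle x,y\rangle)_+^{s}}{f(x)},\qquad (a)_+=\max\{a,0\}.$$ $\mathbf{B}^d$ is the Euclidean unit ball of $\mathbb{R}^d$ and $|\cdot|$ is the Euclidean norm. *)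

theory Defs
  imports "HOL-Analysis.Analysis"
begin

text \<open>\<^const>\<open>concave_on\<close> includes convexity of the set, so the support of \<open>f\<close> is
  required to be convex.\<close>

definition inv_concave :: "real \<Rightarrow> ('a::euclidean_space \<Rightarrow> real) \<Rightarrow> bool" where
  "inv_concave s f \<longleftrightarrow> concave_on {x. f x > 0} (\<lambda>x. f x powr (1 / s))"

text \<open>The values are taken in \<^typ>\<open>ennreal\<close> so that the infimum over an empty support is
  \<open>\<infinity>\<close> and so that the integral of the transform is meaningful without integrability.\<close>

definition s_polar :: "real \<Rightarrow> ('a::euclidean_space \<Rightarrow> real) \<Rightarrow> 'a \<Rightarrow> ennreal" where
  "s_polar s f y = (INF x\<in>{x. f x > 0}. ennreal (max (1 - x \<bullet> y) 0 powr s / f x))"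

end

theory Submission
  imports Defs "HOL-Probability.Distribution_Functions"
begin

text \<open>The proof is an induction on the dimension in the spirit of Lehec's proof of the functional
Santalo inequality. Call $g$ dominated by the polar of $f$ at $z$ if
$f(x+z)\,g(y)\le(1-\langle x,y\rangle)_+^s$ for all $x$ and $y$. The $s$-polar transform of
$f_{[z]}$ is the largest such $g$, and the estimate is proved for every measurable $g$ of this kind. The
barycentres of $f$ exist because a $1/s$-concave function with finite positive integral has bounded
support (\<open>bounded_support\<close>).

On a half-line the inequality is the Prekopa-Leindler inequality after the substitution $t=e^p$
(\<open>half_line_santalo\<close>). In higher dimension, let $b_+$ and $b_-$ be the barycentres of $f$ on the two sides of
$H$, let $z$ be the point where the segment $[b_-,b_+]$ meets $H$, and let $v$ be its direction.
Integrating $f$ over half-lines parallel to $v$ on one side of $H$, and $g$ over half-lines in the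
dual splitting, gives two functions in one dimension less; by the half-line inequality the second
is dominated, up to a constant, by the polar of the first at $0$, with exponent $s+1$ in place of
$s$ (\<open>half_space_santalo\<close>). By the choice of $v$ the first has its barycentre at $0$, and the
induction hypothesis for functions with barycentre $0$ (\<open>centred_santalo\<close>) applies. It gives
$\lambda\int f\int_{V_+} g\le\kappa^2/4$ and $(1-\lambda)\int f\int_{V_-} g\le\kappa^2/4$, where
$V_\pm$ are the half-spaces bounded by $v^\perp$. Their combination is the
claim (\<open>hyperplane_santalo\<close>).

To close the induction, the statement about hyperplanes has to imply the one about barycentres. Let
$F$ have barycentre $0$ and let $G$ be dominated by its polar at $0$. The hyperplane statement, applied to
$G$ and a hyperplane that halves it, gives a point $z$; in terms of $F$, polarity at $z$ is
polarity at $0$ after a projective change of variables, and $F$ contributes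
$\int F(x)(1-\langle x,z\rangle)^{-(s+d+1)}dx$, which is at least $\int F$ because the weight is
convex in $\langle x,z\rangle$ and the barycentre is $0$
(\<open>projective_pull_integral_ge\<close>, \<open>centred_santalo_insert\<close>).\<close>

section \<open>The Prekopa-Leindler inequality on the line\<close>

text \<open>Inner regularity. The compact sets are kept nonempty because a sumset with the empty set is empty.\<close>

lemma emeasure_lborel_le_SUP_compact:
  fixes A :: "real set"
  assumes A: "A \<in> sets borel" and ne: "a \<in> A"
  shows "emeasure lborel A \<le> (SUP K\<in>{K. compact K \<and> K \<noteq> {} \<and> K \<subseteq> A}. emeasure lborel K)"
proof (rule dense_le)
  fix r assume r: "r < emeasure lborel A"
  have "(SUP n::nat. emeasure lborel (A \<inter> {-real n..real n})) = emeasure lborel (\<Union>n::nat. A \<inter> {-real n..real n})"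
    by (rule SUP_emeasure_incseq) (use A in \<open>auto simp: incseq_def\<close>)
  also have "(\<Union>n::nat. A \<inter> {-real n..real n}) = A"
  proof -
    have "\<exists>n::nat. -real n \<le> x \<and> x \<le> real n" for x
      using real_arch_simple[of "\<bar>x\<bar>"] by (metis abs_le_iff minus_le_iff)
    then show ?thesis by auto
  qed
  finally have "r < (SUP n::nat. emeasure lborel (A \<inter> {-real n..real n}))" using r by simp
  then obtain n :: nat where n: "r < emeasure lborel (A \<inter> {-real n..real n})"
    unfolding less_SUP_iff by auto
  define B where "B = A \<inter> {-real n..real n}"
  have B: "B \<in> sets borel" unfolding B_def using A by auto
  have Bf: "emeasure lborel B < \<infinity>"
    unfolding B_def by (rule le_less_trans[OF emeasure_mono[of _ "{-real n..real n}"]]) auto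
  define e where "e = enn2real (emeasure lborel B) - enn2real r"
  have rf: "r < \<infinity>" using n Bf unfolding B_def by (meson less_trans)
  have e: "e > 0" unfolding e_def using n Bf rf
    by (simp add: B_def enn2real_less_iff less_top)
  obtain T where T: "closed T" "T \<subseteq> B" "B - T \<in> lmeasurable" "emeasure lebesgue (B - T) < ennreal e"
    using sets_lebesgue_inner_closed[of B e] B e by auto
  have Tc: "compact T" using T(1,2) unfolding B_def
    by (metis bounded_closed_interval bounded_subset compact_eq_bounded_closed inf.boundedE)
  have "emeasure lborel B \<le> emeasure lborel T + emeasure lborel (B - T)"
    using emeasure_subadditive[of T lborel "B - T"] T(1,2) B by (auto simp: Un_absorb1)
  also have "emeasure lborel (B - T) = emeasure lebesgue (B - T)"
    using T(1) B by simp
  finally have 1: "emeasure lborel B \<le> emeasure lborel T + emeasure lebesgue (B - T)" .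
  have Tf: "emeasure lborel T < \<infinity>"
    by (rule le_less_trans[OF emeasure_mono[OF T(2)] Bf]) (use B in auto)
  have "r \<le> emeasure lborel T"
  proof (rule ccontr)
    assume "\<not> r \<le> emeasure lborel T"
    then have "emeasure lborel T < r" by simp
    then have "emeasure lborel T + emeasure lebesgue (B - T) < r + ennreal e"
      using T(4) by (rule add_strict_mono)
    also have "r + ennreal e = emeasure lborel B"
    proof -
      have "ennreal (enn2real r) + ennreal e = ennreal (enn2real (emeasure lborel B))"
        unfolding e_def by (subst ennreal_plus[symmetric]) (use e e_def in auto)
      then show ?thesis using rf Bf by (simp add: less_top)
    qed
    finally show False using 1 by simp
  qed
  also have "\<dots> \<le> emeasure lborel (insert a T)"
    by (rule emeasure_mono) (use T(1) in auto)
  also have "\<dots> \<le> (SUP K\<in>{K. compact K \<and> K \<noteq> {} \<and> K \<subseteq> A}. emeasure lborel K)"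
    by (rule SUP_upper) (use Tc T(2) ne B_def in auto)
  finally show "r \<le> \<dots>" .
qed

text \<open>The translates of \<open>A\<close> by the least point of \<open>B\<close> and of \<open>B\<close> by the greatest point of \<open>A\<close> both lie in
the sumset, and they overlap in one point only.\<close>

lemma brunn_minkowski_compact:
  fixes A B :: "real set"
  assumes A: "compact A" "A \<noteq> {}" and B: "compact B" "B \<noteq> {}" and C: "C \<in> sets borel"
    and AB: "\<And>a b. a \<in> A \<Longrightarrow> b \<in> B \<Longrightarrow> (a + b) / 2 \<in> C"
  shows "emeasure lborel A + emeasure lborel B \<le> 2 * emeasure lborel C"
proof -
  obtain b where b: "b \<in> B" "\<And>x. x \<in> B \<Longrightarrow> b \<le> x" using compact_attains_inf[OF B] by auto
  obtain a where a: "a \<in> A" "\<And>x. x \<in> A \<Longrightarrow> x \<le> a" using compact_attains_sup[OF A] by auto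
  have [measurable]: "A \<in> sets borel" "B \<in> sets borel" using A B by (auto intro: borel_compact)
  note C[measurable]
  have aff: "emeasure lborel S = (\<integral>\<^sup>+x. indicator S (x - t) \<partial>lborel)" if "S \<in> sets borel" for S and t :: real
    using nn_integral_real_affine[of "indicator S" 1 "-t"] that by simp
  have "emeasure lborel A + emeasure lborel B = (\<integral>\<^sup>+x. indicator A (x - b) + indicator B (x - a) \<partial>lborel)"
    by (subst nn_integral_add) (simp_all add: aff[of A b] aff[of B a])
  also have "\<dots> \<le> (\<integral>\<^sup>+x. indicator C (0 + (1/2) * x) \<partial>lborel)"
  proof (rule nn_integral_mono_AE)
    have "AE x in lborel. x \<noteq> a + b" by (rule AE_lborel_singleton)
    then show "AE x in lborel. indicator A (x - b) + indicator B (x - a) \<le> (indicator C (0 + (1/2) * x) :: ennreal)"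
    proof eventually_elim
      case (elim x)
      have "x \<le> a + b" "x / 2 \<in> C" if "x - b \<in> A" using a(2)[OF that] AB[OF that b(1)] by auto
      moreover have "x \<ge> a + b" "x / 2 \<in> C" if "x - a \<in> B" using b(2)[OF that] AB[OF a(1) that] by auto
      ultimately show ?case using elim by (auto simp: indicator_def)
    qed
  qed
  also have "\<dots> = 2 * emeasure lborel C"
  proof -
    have "emeasure lborel C = ennreal \<bar>1/2\<bar> * (\<integral>\<^sup>+x. indicator C (0 + (1/2) * x) \<partial>lborel)"
      using nn_integral_real_affine[of "indicator C" "1/2" 0] by (simp only: nn_integral_indicator C sets_lborel) simp
    moreover have "2 * ennreal \<bar>1/2\<bar> = 1"
      using ennreal_mult[of 2 "1/2"] by simp
    ultimately show ?thesis by (simp only: mult.assoc[symmetric]) simp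
  qed
  finally show ?thesis .
qed

lemma brunn_minkowski_real:
  fixes A B :: "real set"
  assumes A: "A \<in> sets borel" "A \<noteq> {}" and B: "B \<in> sets borel" "B \<noteq> {}" and C: "C \<in> sets borel"
    and AB: "\<And>a b. a \<in> A \<Longrightarrow> b \<in> B \<Longrightarrow> (a + b) / 2 \<in> C"
  shows "emeasure lborel A + emeasure lborel B \<le> 2 * emeasure lborel C"
proof -
  let ?K = "\<lambda>A. {K. compact K \<and> K \<noteq> {} \<and> K \<subseteq> A} :: real set set"
  obtain a b where ab: "a \<in> A" "b \<in> B" using A B by auto
  have ne: "?K A \<noteq> {}" "?K B \<noteq> {}" using ab by (force intro: exI[of _ "{a}"], force intro: exI[of _ "{b}"])
  have "emeasure lborel A + emeasure lborel B \<le> (SUP K\<in>?K A. emeasure lborel K) + (SUP L\<in>?K B. emeasure lborel L)"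
    by (intro add_mono emeasure_lborel_le_SUP_compact[OF A(1) ab(1)] emeasure_lborel_le_SUP_compact[OF B(1) ab(2)])
  also have "\<dots> = (SUP K\<in>?K A. SUP L\<in>?K B. emeasure lborel K + emeasure lborel L)"
    by (simp only: ennreal_SUP_add_left[OF ne(1)] ennreal_SUP_add_right[OF ne(2), symmetric])
  also have "\<dots> \<le> 2 * emeasure lborel C"
    by (intro SUP_least brunn_minkowski_compact) (use C AB in auto)
  finally show ?thesis .
qed

lemma layer_cake_below_1:
  fixes h :: "real \<Rightarrow> ennreal"
  assumes [measurable]: "h \<in> borel_measurable borel"
  shows "(\<integral>\<^sup>+x. min (h x) 1 \<partial>lborel) = (\<integral>\<^sup>+t\<in>{0..<1}. emeasure lborel {x. ennreal t < h x} \<partial>lborel)"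
proof -
  have "(\<integral>\<^sup>+t\<in>{0..<1}. emeasure lborel {x. ennreal t < h x} \<partial>lborel)
      = (\<integral>\<^sup>+t. (\<integral>\<^sup>+x. indicator {x. ennreal t < h x} x * indicator {0..<1} t \<partial>lborel) \<partial>lborel)"
    by (intro nn_integral_cong) (simp add: nn_integral_multc)
  also have "\<dots> = (\<integral>\<^sup>+t. (\<integral>\<^sup>+x. (if ennreal t < h x \<and> 0 \<le> t \<and> t < 1 then 1 else 0) \<partial>lborel) \<partial>lborel)"
    by (intro nn_integral_cong) (auto simp: indicator_def)
  also have "\<dots> = (\<integral>\<^sup>+x. (\<integral>\<^sup>+t. (if ennreal t < h x \<and> 0 \<le> t \<and> t < 1 then 1 else 0) \<partial>lborel) \<partial>lborel)"
    by (rule lborel_pair.Fubini') measurable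
  also have "\<dots> = (\<integral>\<^sup>+x. min (h x) 1 \<partial>lborel)"
  proof (intro nn_integral_cong)
    fix x
    define r where "r = enn2real (min (h x) 1)"
    have r: "min (h x) 1 = ennreal r" "0 \<le> r" "r \<le> 1"
      unfolding r_def using enn2real_mono[of "min (h x) 1" 1] ennreal_enn2real[of "min (h x) 1"]
      by (auto simp: min_less_iff_disj)
    have "(\<integral>\<^sup>+t. (if ennreal t < h x \<and> 0 \<le> t \<and> t < 1 then 1 else 0) \<partial>lborel)
        = (\<integral>\<^sup>+t. indicator {0..<r} t \<partial>lborel)"
    proof (intro nn_integral_cong)
      fix t :: real
      have "(ennreal t < h x \<and> t < 1) \<longleftrightarrow> t < r" if "0 \<le> t"
      proof -
        have "(ennreal t < h x \<and> t < 1) \<longleftrightarrow> (ennreal t < h x \<and> ennreal t < 1)"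
          using that by (simp add: ennreal_less_one_iff)
        also have "\<dots> \<longleftrightarrow> ennreal t < min (h x) 1" by simp
        also have "\<dots> \<longleftrightarrow> t < r" unfolding r(1) using that by (simp add: ennreal_less_iff)
        finally show ?thesis .
      qed
      then show "(if ennreal t < h x \<and> 0 \<le> t \<and> t < 1 then 1 else 0) = (indicator {0..<r} t :: ennreal)"
        by (auto simp: indicator_def)
    qed
    also have "\<dots> = ennreal r" using r by simp
    finally show "(\<integral>\<^sup>+t. (if ennreal t < h x \<and> 0 \<le> t \<and> t < 1 then 1 else 0) \<partial>lborel) = min (h x) 1"
      using r by simp
  qed
  finally show ?thesis by simp
qed

text \<open>When both suprema equal \<open>1\<close>, the level sets of \<open>h1\<close> and \<open>h2\<close> at each height below \<open>1\<close> are nonempty,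
and their midpoints lie in the level set of \<open>m\<close> at the same height. Brunn-Minkowski on the level
sets, integrated over the height, then gives an additive inequality, which is stronger than the
multiplicative one by the inequality of arithmetic and geometric means.\<close>

lemma prekopa_leindler_sup_1:
  fixes h1 h2 m :: "real \<Rightarrow> ennreal"
  assumes [measurable]: "h1 \<in> borel_measurable borel" "h2 \<in> borel_measurable borel" "m \<in> borel_measurable borel"
    and h: "(SUP x. h1 x) = 1" "(SUP x. h2 x) = 1"
    and le: "\<And>x y. h1 x * h2 y \<le> m ((x + y) / 2) * m ((x + y) / 2)"
  shows "(\<integral>\<^sup>+x. h1 x \<partial>lborel) + (\<integral>\<^sup>+x. h2 x \<partial>lborel) \<le> 2 * (\<integral>\<^sup>+x. m x \<partial>lborel)"
proof -
  have le1: "h1 x \<le> 1" "h2 x \<le> 1" for x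
    using h by (metis SUP_upper UNIV_I)+
  have "(\<integral>\<^sup>+x. h1 x \<partial>lborel) + (\<integral>\<^sup>+x. h2 x \<partial>lborel) =
    (\<integral>\<^sup>+x. min (h1 x) 1 \<partial>lborel) + (\<integral>\<^sup>+x. min (h2 x) 1 \<partial>lborel)"
    using le1 by (simp add: min_absorb1)
  also have "\<dots> = (\<integral>\<^sup>+t. emeasure lborel {x. ennreal t < h1 x} * indicator {0..<1} t
      + emeasure lborel {x. ennreal t < h2 x} * indicator {0..<1} t \<partial>lborel)"
    unfolding layer_cake_below_1[OF assms(1)] layer_cake_below_1[OF assms(2)]
    by (rule nn_integral_add[symmetric]) measurable
  also have "\<dots> \<le> (\<integral>\<^sup>+t. 2 * (emeasure lborel {x. ennreal t < m x} * indicator {0..<1} t) \<partial>lborel)"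
  proof (intro nn_integral_mono)
    fix t :: real
    have "emeasure lborel {x. ennreal t < h1 x} + emeasure lborel {x. ennreal t < h2 x} \<le> 2 * emeasure lborel {x. ennreal t < m x}"
      if t: "0 \<le> t" "t < 1"
    proof (rule brunn_minkowski_real)
      have "ennreal t < 1" using t by (simp add: ennreal_less_one_iff)
      then show "{x. ennreal t < h1 x} \<noteq> {}" "{x. ennreal t < h2 x} \<noteq> {}"
        using less_SUP_iff[of "ennreal t" h1 UNIV] less_SUP_iff[of "ennreal t" h2 UNIV] h by auto
      fix a b assume "a \<in> {x. ennreal t < h1 x}" "b \<in> {x. ennreal t < h2 x}"
      then have *: "ennreal t < h1 a" "ennreal t < h2 b" by auto
      show "(a + b) / 2 \<in> {x. ennreal t < m x}"
      proof (rule ccontr)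
        assume "\<not> ?thesis"
        then have "m ((a+b)/2) * m ((a+b)/2) \<le> ennreal t * ennreal t"
          by (intro mult_mono) auto
        also have "ennreal t * ennreal t < h1 a * h2 b"
        proof -
          obtain p where p: "h1 a = ennreal p" "0 \<le> p" using le1[of a] by (cases "h1 a") (auto simp: top_unique)
          obtain q where q: "h2 b = ennreal q" "0 \<le> q" using le1[of b] by (cases "h2 b") (auto simp: top_unique)
          have "t < p" "t < q" using * p q t by (auto simp: ennreal_less_iff)
          then have "t * t < p * q" using t by (intro mult_strict_mono') auto
          then show ?thesis using p q t by (simp add: ennreal_mult[symmetric] ennreal_less_iff)
        qed
        finally show False using le[of a b] by simp
      qed
    qed measurable
    then show "emeasure lborel {x. ennreal t < h1 x} * indicator {0..<1} t
      + emeasure lborel {x. ennreal t < h2 x} * indicator {0..<1} t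
      \<le> 2 * (emeasure lborel {x. ennreal t < m x} * indicator {0..<1} t)"
      by (auto simp: indicator_def)
  qed
  also have "\<dots> = 2 * (\<integral>\<^sup>+t. (emeasure lborel {x. ennreal t < m x} * indicator {0..<1} t) \<partial>lborel)"
    by (rule nn_integral_cmult) measurable
  also have "\<dots> = 2 * (\<integral>\<^sup>+x. min (m x) 1 \<partial>lborel)"
    by (simp add: layer_cake_below_1)
  also have "\<dots> \<le> 2 * (\<integral>\<^sup>+x. m x \<partial>lborel)"
    by (intro mult_left_mono nn_integral_mono) auto
  finally show ?thesis .
qed

lemma ennreal_AMGM:
  fixes p q r :: ennreal
  assumes "p + q \<le> 2 * r"
  shows "p * q \<le> r * r"
proof (cases "r = top")
  case False
  then obtain r' where r: "r = ennreal r'" "0 \<le> r'" by (cases r) auto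
  have fin: "p + q < top" using assms r by (metis ennreal_mult_less_top ennreal_less_top ennreal_numeral le_less_trans)
  then obtain p' q' where pq: "p = ennreal p'" "q = ennreal q'" "0 \<le> p'" "0 \<le> q'"
    by (cases p; cases q) auto
  have "2 * r = ennreal (2 * r')" using r by (simp add: ennreal_mult)
  then have "p' + q' \<le> 2 * r'" using assms pq r by (simp add: ennreal_plus[symmetric] del: ennreal_plus)
  then have "(p' + q')^2 \<le> (2 * r')^2" using pq r by (intro power_mono) auto
  then have "p' * q' \<le> r' * r'"
    using zero_le_power2[of "p' - q'"] by (simp add: power2_eq_square algebra_simps)
  then show ?thesis using pq r by (simp add: ennreal_mult[symmetric])
qed simp

text \<open>The suprema are brought to \<open>1\<close> by scaling the two functions; the hypothesis and the conclusion are
homogeneous of the same degree in each of them.\<close>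

lemma prekopa_leindler_bounded:
  fixes h1 h2 m :: "real \<Rightarrow> ennreal"
  assumes [measurable]: "h1 \<in> borel_measurable borel" "h2 \<in> borel_measurable borel" "m \<in> borel_measurable borel"
    and bd: "\<And>x. h1 x \<le> ennreal N" "\<And>x. h2 x \<le> ennreal N"
    and le: "\<And>x y. h1 x * h2 y \<le> m ((x + y) / 2) * m ((x + y) / 2)"
  shows "(\<integral>\<^sup>+x. h1 x \<partial>lborel) * (\<integral>\<^sup>+x. h2 x \<partial>lborel) \<le> (\<integral>\<^sup>+x. m x \<partial>lborel) * (\<integral>\<^sup>+x. m x \<partial>lborel)"
proof (cases "(SUP x. h1 x) = 0 \<or> (SUP x. h2 x) = 0")
  case True
  then have "(\<forall>x. h1 x = 0) \<or> (\<forall>x. h2 x = 0)" by (metis SUP_upper UNIV_I le_zero_eq)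
  then have "(\<integral>\<^sup>+x. h1 x \<partial>lborel) = 0 \<or> (\<integral>\<^sup>+x. h2 x \<partial>lborel) = 0"
    by auto
  then show ?thesis by auto
next
  case False
  have "(SUP x. h1 x) \<le> ennreal N" "(SUP x. h2 x) \<le> ennreal N" using bd by (auto intro: SUP_least)
  then obtain a b where ab: "(SUP x. h1 x) = ennreal a" "(SUP x. h2 x) = ennreal b" "0 \<le> a" "0 \<le> b"
    by (metis ennreal_cases ennreal_less_top leD top_neq_ennreal neq_top_trans)
  with False have ab0: "0 < a" "0 < b" by (auto simp: less_le)
  define c where "c = sqrt (1 / (a * b))"
  have c: "c > 0" "c * c = (1/a) * (1/b)" unfolding c_def using ab0 by auto
  let ?I = "\<lambda>h. \<integral>\<^sup>+x. h x \<partial>lborel"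
  have "(\<integral>\<^sup>+x. ennreal (1/a) * h1 x \<partial>lborel) + (\<integral>\<^sup>+x. ennreal (1/b) * h2 x \<partial>lborel) \<le> 2 * (\<integral>\<^sup>+x. ennreal c * m x \<partial>lborel)"
  proof (rule prekopa_leindler_sup_1)
    show "(SUP x. ennreal (1/a) * h1 x) = 1"
      unfolding SUP_mult_left_ennreal[symmetric] ab using ab0 by (simp add: ennreal_mult[symmetric])
    show "(SUP x. ennreal (1/b) * h2 x) = 1"
      unfolding SUP_mult_left_ennreal[symmetric] ab using ab0 by (simp add: ennreal_mult[symmetric])
    fix x y
    have "ennreal (1/a) * h1 x * (ennreal (1/b) * h2 y) = ennreal (c * c) * (h1 x * h2 y)"
      unfolding c using ab0 by (subst ennreal_mult) (auto simp: mult_ac)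
    also have "\<dots> \<le> ennreal (c * c) * (m ((x + y) / 2) * m ((x + y) / 2))"
      by (intro mult_left_mono le) auto
    also have "\<dots> = ennreal c * m ((x + y) / 2) * (ennreal c * m ((x + y) / 2))"
      using c by (subst ennreal_mult) (auto simp: mult_ac)
    finally show "ennreal (1/a) * h1 x * (ennreal (1/b) * h2 y) \<le> ennreal c * m ((x + y) / 2) * (ennreal c * m ((x + y) / 2))" .
  qed measurable
  then have "ennreal (1/a) * ?I h1 + ennreal (1/b) * ?I h2 \<le> 2 * (ennreal c * ?I m)"
    by (simp add: nn_integral_cmult)
  from ennreal_AMGM[OF this]
  have "ennreal (a * b) * (ennreal (1/a) * ?I h1 * (ennreal (1/b) * ?I h2)) \<le> ennreal (a * b) * (ennreal c * ?I m * (ennreal c * ?I m))"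
    by (rule mult_left_mono) auto
  also have "\<dots> = ennreal (a * b) * ennreal (c * c) * (?I m * ?I m)"
    using c by (subst ennreal_mult[of c c]) (auto simp: mult_ac)
  also have "ennreal (a * b) * ennreal (c * c) = 1"
    unfolding c using ab0 by (simp add: ennreal_mult[symmetric])
  also have "ennreal (a * b) * (ennreal (1/a) * ?I h1 * (ennreal (1/b) * ?I h2)) =
    ennreal (a * b) * (ennreal (1/a) * ennreal (1/b)) * (?I h1 * ?I h2)" by (simp add: mult_ac)
  also have "ennreal (a * b) * (ennreal (1/a) * ennreal (1/b)) = 1"
    using ab0 by (simp add: ennreal_mult[symmetric])
  finally show ?thesis by simp
qed

lemma SUP_min_nat: "(SUP n::nat. min (x::ennreal) (of_nat n)) = x"
proof (rule antisym)
  show "x \<le> (SUP n::nat. min x (of_nat n))"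
  proof (cases x)
    case (real r)
    then obtain n :: nat where "r \<le> real n" using real_arch_simple by auto
    then have "x \<le> of_nat n" using real by (simp add: ennreal_of_nat_eq_real_of_nat)
    then have "x \<le> min x (of_nat n)" by simp
    also have "\<dots> \<le> (SUP n::nat. min x (of_nat n))" by (rule SUP_upper) simp
    finally show ?thesis .
  qed (simp add: ennreal_SUP_of_nat_eq_top)
qed (auto intro: SUP_least)

text \<open>The Prekopa-Leindler inequality on the line, with weights \<open>1/2\<close>. The truncations at height \<open>n\<close>
inherit the hypothesis, so the bounded case and monotone convergence suffice.\<close>

lemma prekopa_leindler:
  fixes h1 h2 m :: "real \<Rightarrow> ennreal"
  assumes [measurable]: "h1 \<in> borel_measurable borel" "h2 \<in> borel_measurable borel" "m \<in> borel_measurable borel"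
    and le: "\<And>x y. h1 x * h2 y \<le> m ((x + y) / 2) * m ((x + y) / 2)"
  shows "(\<integral>\<^sup>+x. h1 x \<partial>lborel) * (\<integral>\<^sup>+x. h2 x \<partial>lborel) \<le> (\<integral>\<^sup>+x. m x \<partial>lborel) * (\<integral>\<^sup>+x. m x \<partial>lborel)"
proof -
  let ?t = "\<lambda>h (n::nat) x. min (h x) (of_nat n) :: ennreal"
  have inc: "incseq (?t h)" for h :: "real \<Rightarrow> ennreal"
    by (auto simp: incseq_def le_fun_def min_def intro: order_trans)
  have mc: "(\<integral>\<^sup>+x. h x \<partial>lborel) = (SUP n. \<integral>\<^sup>+x. ?t h n x \<partial>lborel)"
    if [measurable]: "h \<in> borel_measurable borel" for h :: "real \<Rightarrow> ennreal"
    by (subst nn_integral_monotone_convergence_SUP[OF inc, symmetric]) (auto simp: SUP_min_nat)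
  have inc': "incseq (\<lambda>n. \<integral>\<^sup>+x. ?t h n x \<partial>lborel)" for h :: "real \<Rightarrow> ennreal"
    using inc[of h] by (auto simp: incseq_def le_fun_def intro!: nn_integral_mono)
  have "(\<integral>\<^sup>+x. ?t h1 k x \<partial>lborel) * (\<integral>\<^sup>+x. ?t h2 n x \<partial>lborel) \<le> (\<integral>\<^sup>+x. m x \<partial>lborel) * (\<integral>\<^sup>+x. m x \<partial>lborel)" for k n
  proof -
    have "(\<integral>\<^sup>+x. ?t h1 k x \<partial>lborel) * (\<integral>\<^sup>+x. ?t h2 n x \<partial>lborel) \<le>
      (\<integral>\<^sup>+x. ?t h1 (max k n) x \<partial>lborel) * (\<integral>\<^sup>+x. ?t h2 (max k n) x \<partial>lborel)"
      using inc' by (intro mult_mono) (auto simp: incseq_def)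
    also have "\<dots> \<le> (\<integral>\<^sup>+x. m x \<partial>lborel) * (\<integral>\<^sup>+x. m x \<partial>lborel)"
    proof (rule prekopa_leindler_bounded)
      show "?t h1 (max k n) x \<le> ennreal (real (max k n))" for x by (simp add: ennreal_of_nat_eq_real_of_nat)
      show "?t h2 (max k n) x \<le> ennreal (real (max k n))" for x by (simp add: ennreal_of_nat_eq_real_of_nat)
      show "?t h1 (max k n) x * ?t h2 (max k n) y \<le> m ((x + y) / 2) * m ((x + y) / 2)" for x y
        by (rule order_trans[OF mult_mono le]) auto
    qed measurable
    finally show ?thesis .
  qed
  then show ?thesis unfolding mc[OF assms(1)] mc[OF assms(2)]
    by (simp add: SUP_mult_right_ennreal SUP_mult_left_ennreal) (meson SUP_least)
qed

section \<open>The Santalo inequality on the half-line\<close>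

lemma nn_integral_exp:
  fixes f :: "real \<Rightarrow> ennreal"
  assumes [measurable]: "f \<in> borel_measurable borel"
  shows "(\<integral>\<^sup>+t. f t * indicator {0<..} t \<partial>lborel) = (\<integral>\<^sup>+p. f (exp p) * ennreal (exp p) \<partial>lborel)"
proof -
  let ?A = "\<lambda>n::nat. {exp (- real (Suc n))..exp (real (Suc n))}" and ?B = "\<lambda>n::nat. {- real (Suc n)..real (Suc n)}"
  have eq: "(\<integral>\<^sup>+t. f t * indicator (?A n) t \<partial>lborel) = (\<integral>\<^sup>+p. f (exp p) * ennreal (exp p) * indicator (?B n) p \<partial>lborel)" for n
    by (rule nn_integral_substitution_aux) (auto intro!: derivative_eq_intros continuous_intros)
  have inc: "incseq (\<lambda>n t. g t * (indicator (S n) t :: ennreal))" if "incseq S" for g and S :: "nat \<Rightarrow> real set"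
    using that by (auto simp: incseq_def le_fun_def indicator_def intro!: mult_left_mono)
  have incA: "incseq ?A" and incB: "incseq ?B"
    by (auto simp: incseq_def elim!: order_trans[rotated] order_trans)
  have A: "(SUP n. f t * indicator (?A n) t) = f t * indicator {0<..} t" for t :: real
  proof (cases "t > 0")
    case True
    obtain n :: nat where "\<bar>ln t\<bar> \<le> real n" using real_arch_simple by auto
    then have "- real (Suc n) \<le> ln t" "ln t \<le> real (Suc n)" by auto
    then have "t \<in> ?A n" using True exp_le_cancel_iff[of _ "ln t"] exp_le_cancel_iff[of "ln t"] by (auto simp del: exp_le_cancel_iff)
    then have "f t * indicator {0<..} t \<le> f t * indicator (?A n) t" using True by simp
    also have "\<dots> \<le> (SUP n. f t * indicator (?A n) t)" by (rule SUP_upper) simp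
    finally show ?thesis using True by (intro antisym SUP_least) (auto simp: indicator_def)
  next
    case False
    then have "t \<notin> ?A n" for n using less_le_trans[of 0 "exp (- real (Suc n))" t] by auto
    then show ?thesis using False by simp
  qed
  have B: "(SUP n. f (exp p) * ennreal (exp p) * indicator (?B n) p) = f (exp p) * ennreal (exp p)" for p :: real
  proof -
    obtain n :: nat where "\<bar>p\<bar> \<le> real n" using real_arch_simple by auto
    then have "p \<in> ?B n" by auto
    then have "f (exp p) * ennreal (exp p) \<le> f (exp p) * ennreal (exp p) * indicator (?B n) p" by simp
    also have "\<dots> \<le> (SUP n. f (exp p) * ennreal (exp p) * indicator (?B n) p)" by (rule SUP_upper) simp
    finally show ?thesis by (intro antisym SUP_least) (auto simp: indicator_def)
  qed
  have "(\<integral>\<^sup>+t. f t * indicator {0<..} t \<partial>lborel) = (SUP n. \<integral>\<^sup>+t. f t * indicator (?A n) t \<partial>lborel)"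
    unfolding A[symmetric]
    by (rule nn_integral_monotone_convergence_SUP[OF inc[OF incA]]) measurable
  also have "\<dots> = (SUP n. \<integral>\<^sup>+p. f (exp p) * ennreal (exp p) * indicator (?B n) p \<partial>lborel)"
    unfolding eq ..
  also have "\<dots> = (\<integral>\<^sup>+p. (SUP n. f (exp p) * ennreal (exp p) * indicator (?B n) p) \<partial>lborel)"
    by (rule nn_integral_monotone_convergence_SUP[OF inc[OF incB], symmetric]) measurable
  finally show ?thesis unfolding B .
qed

text \<open>The kernel $a_+^s$ of the $s$-polar transform; for $a\le 0$ it vanishes because \<open>0 powr s = 0\<close>.\<close>

definition pos_powr :: "real \<Rightarrow> real \<Rightarrow> ennreal" where
  "pos_powr s a = ennreal (max a 0 powr s)"

lemma pos_powr_measurable [measurable]: "pos_powr s \<in> borel_measurable borel"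
  unfolding pos_powr_def[abs_def] by measurable

lemma pos_powr_half: "pos_powr (s / 2) a * pos_powr (s / 2) a = pos_powr s a"
  unfolding pos_powr_def by (simp add: ennreal_mult[symmetric] powr_add[symmetric])

text \<open>The substitution $t = e^p$ turns the product $tr$ into a sum and the geometric mean into a
midpoint, so this is the Prekopa-Leindler inequality for $\varphi(e^p)e^p$, $\psi(e^p)e^p$ and
$(a-e^{2p})_+^{s/2}e^p$. It is a Santalo inequality for the half-line.\<close>

lemma half_line_santalo:
  fixes \<phi> \<psi> :: "real \<Rightarrow> ennreal"
  assumes [measurable]: "\<phi> \<in> borel_measurable borel" "\<psi> \<in> borel_measurable borel"
    and le: "\<And>t r. t > 0 \<Longrightarrow> r > 0 \<Longrightarrow> \<phi> t * \<psi> r \<le> pos_powr s (a - t * r)"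
  shows "(\<integral>\<^sup>+t. \<phi> t * indicator {0<..} t \<partial>lborel) * (\<integral>\<^sup>+r. \<psi> r * indicator {0<..} r \<partial>lborel)
    \<le> (\<integral>\<^sup>+t. pos_powr (s / 2) (a - t\<^sup>2) * indicator {0<..} t \<partial>lborel)\<^sup>2"
  unfolding nn_integral_exp[OF assms(1)] nn_integral_exp[OF assms(2)]
proof (subst nn_integral_exp, simp, unfold power2_eq_square[of "integral\<^sup>N _ _"], rule prekopa_leindler)
  fix x y :: real
  have e: "exp ((x + y) / 2) * exp ((x + y) / 2) = exp x * exp y"
    by (simp add: exp_add[symmetric])
  have "\<phi> (exp x) * ennreal (exp x) * (\<psi> (exp y) * ennreal (exp y))
    = (\<phi> (exp x) * \<psi> (exp y)) * (ennreal (exp x * exp y))" by (simp add: ennreal_mult mult_ac)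
  also have "\<dots> \<le> pos_powr s (a - exp x * exp y) * (ennreal (exp x * exp y))"
    by (intro mult_right_mono le) auto
  also have "\<dots> = (pos_powr (s / 2) (a - (exp ((x + y) / 2))\<^sup>2) * pos_powr (s / 2) (a - (exp ((x + y) / 2))\<^sup>2)) * ennreal (exp ((x + y) / 2) * exp ((x + y) / 2))"
    unfolding power2_eq_square e pos_powr_half ..
  also have "\<dots> = (pos_powr (s / 2) (a - (exp ((x + y) / 2))\<^sup>2) * ennreal (exp ((x + y) / 2))) * (pos_powr (s / 2) (a - (exp ((x + y) / 2))\<^sup>2) * ennreal (exp ((x + y) / 2)))"
    by (simp add: ennreal_mult mult_ac)
  finally show "\<phi> (exp x) * ennreal (exp x) * (\<psi> (exp y) * ennreal (exp y)) \<le> \<dots>" .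
qed measurable

text \<open>For $s>0$ this is $\frac12 B\bigl(\frac12,\frac s2+1\bigr)$, half a value of the Beta function.\<close>

definition half_line_const :: "real \<Rightarrow> ennreal" where
  "half_line_const s = (\<integral>\<^sup>+t. pos_powr (s / 2) (1 - t\<^sup>2) * indicator {0<..} t \<partial>lborel)"

text \<open>The square of the left-hand side is a constant times the kernel with exponent \<open>s + 1\<close>. This is what
makes an induction on the dimension possible: the dimension drops by one while \<open>s\<close> grows by one.\<close>

lemma half_line_const_scale:
  assumes "s > 0"
  shows "(\<integral>\<^sup>+t. pos_powr (s / 2) (a - t\<^sup>2) * indicator {0<..} t \<partial>lborel) = pos_powr ((s + 1) / 2) a * half_line_const s"
proof (cases "a > 0")
  case True
  have "(\<integral>\<^sup>+t. pos_powr (s / 2) (a - t\<^sup>2) * indicator {0<..} t \<partial>lborel)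
     = ennreal \<bar>sqrt a\<bar> * (\<integral>\<^sup>+t. pos_powr (s / 2) (a - (0 + sqrt a * t)\<^sup>2) * indicator {0<..} (0 + sqrt a * t) \<partial>lborel)"
    by (rule nn_integral_real_affine) (use True in auto)
  also have "(\<integral>\<^sup>+t. pos_powr (s / 2) (a - (0 + sqrt a * t)\<^sup>2) * indicator {0<..} (0 + sqrt a * t) \<partial>lborel)
    = (\<integral>\<^sup>+t. pos_powr (s / 2) a * (pos_powr (s / 2) (1 - t\<^sup>2) * indicator {0<..} t) \<partial>lborel)"
  proof (intro nn_integral_cong)
    fix t :: real
    have "max (a - a * t\<^sup>2) 0 = max a 0 * max (1 - t\<^sup>2) 0"
      using True by (simp add: max_def zero_le_mult_iff algebra_simps)
    then have "pos_powr (s / 2) (a - a * t\<^sup>2) = pos_powr (s / 2) a * pos_powr (s / 2) (1 - t\<^sup>2)"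
      unfolding pos_powr_def by (simp add: ennreal_mult[symmetric] powr_mult)
    then show "pos_powr (s / 2) (a - (0 + sqrt a * t)\<^sup>2) * indicator {0<..} (0 + sqrt a * t)
      = pos_powr (s / 2) a * (pos_powr (s / 2) (1 - t\<^sup>2) * indicator {0<..} t)"
      using True by (simp add: power_mult_distrib indicator_def zero_less_mult_iff mult.assoc)
  qed
  also have "\<dots> = pos_powr (s / 2) a * half_line_const s"
    unfolding half_line_const_def by (rule nn_integral_cmult) measurable
  also have "ennreal \<bar>sqrt a\<bar> * \<dots> = pos_powr ((s + 1) / 2) a * half_line_const s"
  proof -
    have "ennreal \<bar>sqrt a\<bar> * pos_powr (s / 2) a = pos_powr ((s + 1) / 2) a"
      using True unfolding pos_powr_def
      by (simp add: ennreal_mult[symmetric] powr_half_sqrt[symmetric] powr_add[symmetric] add_divide_distrib add.commute)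
    then show ?thesis by (simp only: mult.assoc[symmetric])
  qed
  finally show ?thesis .
next
  case False
  have "a - t\<^sup>2 \<le> 0" for t using False zero_le_power2[of t] by linarith
  then show ?thesis using False assms by (simp add: pos_powr_def max_absorb2)
qed

lemma half_line_const_nonzero: "half_line_const s \<noteq> 0"
proof
  assume "half_line_const s = 0"
  then have "AE t in lborel. pos_powr (s / 2) (1 - t\<^sup>2) * indicator {0<..} t = 0"
    unfolding half_line_const_def by (subst (asm) nn_integral_0_iff_AE) auto
  moreover have "pos_powr (s / 2) (1 - t\<^sup>2) * indicator {0<..} t \<noteq> 0" if "t \<in> {0<..<1}" for t :: real
  proof -
    have "t\<^sup>2 < 1" using that by (simp add: power_less_one_iff)
    then show ?thesis using that by (auto simp: pos_powr_def indicator_def)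
  qed
  ultimately have "AE t in lborel. t \<notin> {0<..<1::real}"
    by (elim AE_mp) (auto intro!: AE_I2)
  then have "emeasure lborel {0<..<1::real} = 0" by (subst (asm) AE_iff_null_sets[symmetric]) auto
  then show False by simp
qed

lemma half_line_const_finite: "s > 0 \<Longrightarrow> half_line_const s < \<infinity>"
proof -
  assume s: "s > 0"
  have "half_line_const s \<le> (\<integral>\<^sup>+t. (indicator {0..1::real} t :: ennreal) \<partial>lborel)"
    unfolding half_line_const_def
  proof (rule nn_integral_mono)
    fix t :: real
    show "pos_powr (s / 2) (1 - t\<^sup>2) * indicator {0<..} t \<le> indicator {0..1} t"
    proof (cases "0 < t \<and> t \<le> 1")
      case True
      then have "t\<^sup>2 \<le> 1" by (simp add: power_le_one)
      then have "max (1 - t\<^sup>2) 0 powr (s/2) \<le> 1" using s by (intro powr_le1) auto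
      then show ?thesis using True by (auto simp: pos_powr_def indicator_def)
    next
      case False
      have "1 - t\<^sup>2 < 0" if "t > 1" using that by (simp add: one_less_power)
      then show ?thesis using False by (auto simp: pos_powr_def indicator_def max_absorb2)
    qed
  qed
  also have "\<dots> < \<infinity>" by simp
  finally show ?thesis .
qed

section \<open>Lebesgue measure in coordinates\<close>

text \<open>Induction on the dimension needs the dimension to be a term and not a type, so the argument is
carried out for functions on a finite index set with the product of Lebesgue measures.\<close>

abbreviation coords :: "'i set \<Rightarrow> ('i \<Rightarrow> real) measure" where
  "coords I \<equiv> Pi\<^sub>M I (\<lambda>_. lborel)"

interpretation coords: product_sigma_finite "\<lambda>_::'i. lborel :: real measure"
  by standard

definition ip :: "'i set \<Rightarrow> ('i \<Rightarrow> real) \<Rightarrow> ('i \<Rightarrow> real) \<Rightarrow> real" where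
  "ip I x y = (\<Sum>i\<in>I. x i * y i)"

lemma measurable_ip [measurable (raw)]:
  assumes "\<And>i. i \<in> I \<Longrightarrow> (\<lambda>w. f w i) \<in> borel_measurable M" "\<And>i. i \<in> I \<Longrightarrow> (\<lambda>w. g w i) \<in> borel_measurable M"
  shows "(\<lambda>w. ip I (f w) (g w)) \<in> borel_measurable M"
  unfolding ip_def using assms by (intro borel_measurable_sum borel_measurable_times)

lemma measurable_coord:
  assumes f: "f \<in> measurable M (coords J)" and "i \<in> J"
  shows "(\<lambda>w. f w i) \<in> borel_measurable M"
  using measurable_compose[OF f measurable_component_singleton[of i J "\<lambda>_. lborel"]] assms by simp

lemma measurable_coords_upd [measurable (raw)]:
  assumes f: "f \<in> measurable M (coords I)" and g: "g \<in> borel_measurable M"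
  shows "(\<lambda>w. (f w)(k := g w)) \<in> measurable M (coords (insert k I))"
proof (rule measurable_PiM_single')
  fix i assume "i \<in> insert k I"
  then show "(\<lambda>w. ((f w)(k := g w)) i) \<in> measurable M lborel"
    using measurable_coord[OF f, of i] g by (cases "i = k") auto
next
  show "(\<lambda>w. (f w)(k := g w)) \<in> space M \<rightarrow> (\<Pi>\<^sub>E i\<in>insert k I. space lborel)"
    using measurable_space[OF f] by (auto simp: space_PiM PiE_iff extensional_def)
qed

lemma ip_insert:
  assumes "finite I" "k \<notin> I"
  shows "ip (insert k I) (x(k := t)) (y(k := r)) = ip I x y + t * r"
proof -
  have "(\<Sum>i\<in>I. (x(k := t)) i * (y(k := r)) i) = (\<Sum>i\<in>I. x i * y i)"
    using assms by (intro sum.cong) auto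
  then show ?thesis using assms by (simp add: ip_def)
qed

lemma ip_cong: "(\<And>i. i \<in> I \<Longrightarrow> x i = x' i) \<Longrightarrow> (\<And>i. i \<in> I \<Longrightarrow> y i = y' i) \<Longrightarrow> ip I x y = ip I x' y'"
  unfolding ip_def by (intro sum.cong) auto

lemma ip_restrict [simp]: "ip I (restrict x I) y = ip I x y" "ip I x (restrict y I) = ip I x y"
  by (auto intro: ip_cong)

lemma ip_commute: "ip I x y = ip I y x" by (simp add: ip_def mult.commute)

lemma ip_add: "ip I (\<lambda>i. x i + y i) w = ip I x w + ip I y w"
  by (simp add: ip_def sum.distrib algebra_simps)

lemma ip_scale: "ip I (\<lambda>i. a * x i) w = a * ip I x w"
  by (simp add: ip_def sum_distrib_left algebra_simps)

lemma ip_upd [simp]: "k \<notin> I \<Longrightarrow> ip I (x(k := t)) y = ip I x y" "k \<notin> I \<Longrightarrow> ip I x (y(k := t)) = ip I x y"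
  by (auto intro: ip_cong)

lemma measurable_ip_const [measurable]: "I \<subseteq> J \<Longrightarrow> (\<lambda>x. ip I x y) \<in> borel_measurable (coords J)"
  "I \<subseteq> J \<Longrightarrow> (\<lambda>x. ip I y x) \<in> borel_measurable (coords J)"
  unfolding ip_def by (auto intro!: borel_measurable_sum borel_measurable_times intro: measurable_component_singleton)

lemma nn_integral_coords_affine:
  assumes "finite I" "a \<noteq> 0" "h \<in> borel_measurable (coords I)"
  shows "(\<integral>\<^sup>+x. h x \<partial>coords I) = ennreal (\<bar>a\<bar> ^ card I) * (\<integral>\<^sup>+x. h (\<lambda>i\<in>I. z i + a * x i) \<partial>coords I)"
  using assms(1,3)
proof (induction I arbitrary: h rule: finite_induct)
  case empty
  have "(\<lambda>i\<in>{}. z i + a * x i) = (\<lambda>_. undefined)" for x by auto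
  then show ?case by (simp add: coords.nn_integral_empty PiM_empty nn_integral_count_space_finite)
next
  case (insert k I)
  note [measurable] = insert.prems
  have [simp]: "finite I" "k \<notin> I" by fact+
  have upd: "(\<lambda>i\<in>insert k I. z i + a * (x(k := t)) i) = (\<lambda>i\<in>I. z i + a * x i)(k := z k + a * t)" for x t
    using \<open>k \<notin> I\<close> by (auto simp: fun_eq_iff restrict_def)
  have "(\<integral>\<^sup>+x. h x \<partial>coords (insert k I)) = (\<integral>\<^sup>+x. (\<integral>\<^sup>+t. h (x(k := t)) \<partial>lborel) \<partial>coords I)"
    by (rule coords.product_nn_integral_insert) auto
  also have "\<dots> = (\<integral>\<^sup>+x. ennreal \<bar>a\<bar> * (\<integral>\<^sup>+t. h (x(k := z k + a * t)) \<partial>lborel) \<partial>coords I)"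
    by (intro nn_integral_cong nn_integral_real_affine) (use \<open>a \<noteq> 0\<close> in measurable)
  also have "\<dots> = ennreal \<bar>a\<bar> * (\<integral>\<^sup>+x. (\<integral>\<^sup>+t. h (x(k := z k + a * t)) \<partial>lborel) \<partial>coords I)"
    by (rule nn_integral_cmult) measurable
  also have "\<dots> = ennreal \<bar>a\<bar> * (ennreal (\<bar>a\<bar> ^ card I) *
      (\<integral>\<^sup>+x. (\<integral>\<^sup>+t. h ((\<lambda>i\<in>I. z i + a * x i)(k := z k + a * t)) \<partial>lborel) \<partial>coords I))"
    by (subst insert.IH) measurable
  also have "\<dots> = ennreal (\<bar>a\<bar> ^ card (insert k I)) *
      (\<integral>\<^sup>+x. (\<integral>\<^sup>+t. h (\<lambda>i\<in>insert k I. z i + a * (x(k := t)) i) \<partial>lborel) \<partial>coords I)"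
    by (simp only: upd) (simp add: ennreal_mult mult.assoc)
  also have "\<dots> = ennreal (\<bar>a\<bar> ^ card (insert k I)) * (\<integral>\<^sup>+x. h (\<lambda>i\<in>insert k I. z i + a * x i) \<partial>coords (insert k I))"
    by (subst coords.product_nn_integral_insert) auto
  finally show ?case .
qed

lemma nn_integral_lborel_coords:
  fixes h :: "'a::euclidean_space \<Rightarrow> ennreal"
  assumes [measurable]: "h \<in> borel_measurable borel"
  shows "(\<integral>\<^sup>+x. h x \<partial>lborel) = (\<integral>\<^sup>+X. h (\<Sum>b\<in>Basis. X b *\<^sub>R b) \<partial>coords Basis)"
  by (subst lborel_eq, subst nn_integral_distr) auto

text \<open>The next two shears are inverse transposes of each other. Together they turn the hyperplane
\<open>ip I X q + X k = const\<close> into \<open>X k = const\<close> and preserve the pairing, so that a general hyperplane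
can be treated as a coordinate hyperplane.\<close>

lemma coords_shear:
  fixes h :: "('i \<Rightarrow> real) \<Rightarrow> ennreal"
  assumes [simp]: "finite I" "k \<notin> I" and [measurable]: "h \<in> borel_measurable (coords (insert k I))"
  shows "(\<integral>\<^sup>+X. h (X(k := X k - ip I X q)) \<partial>coords (insert k I)) = (\<integral>\<^sup>+X. h X \<partial>coords (insert k I))"
proof -
  have [measurable]: "(\<lambda>X. h (X(k := X k - ip I X q))) \<in> borel_measurable (coords (insert k I))"
    using measurable_compose[OF measurable_coords_upd[OF measurable_ident, of "\<lambda>X. X k - ip I X q" "insert k I" k], of h borel]
    by (simp add: insert_absorb)
  have "(\<integral>\<^sup>+X. h (X(k := X k - ip I X q)) \<partial>coords (insert k I)) = (\<integral>\<^sup>+X. (\<integral>\<^sup>+t. h (X(k := t - ip I X q)) \<partial>lborel) \<partial>coords I)"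
    by (subst coords.product_nn_integral_insert) auto
  also have "\<dots> = (\<integral>\<^sup>+X. (\<integral>\<^sup>+t. h (X(k := t)) \<partial>lborel) \<partial>coords I)"
  proof (rule nn_integral_cong)
    fix X assume [measurable]: "X \<in> space (coords I)"
    show "(\<integral>\<^sup>+t. h (X(k := t - ip I X q)) \<partial>lborel) = (\<integral>\<^sup>+t. h (X(k := t)) \<partial>lborel)"
      using nn_integral_real_affine[of "\<lambda>t. h (X(k := t))" 1 "- ip I X q"] by simp
  qed
  also have "\<dots> = (\<integral>\<^sup>+X. h X \<partial>coords (insert k I))"
    by (rule coords.product_nn_integral_insert[symmetric]) auto
  finally show ?thesis .
qed

lemma coords_dual_shear:
  fixes h :: "('i \<Rightarrow> real) \<Rightarrow> ennreal"
  assumes [simp]: "finite I" "k \<notin> I" and [measurable]: "h \<in> borel_measurable (coords (insert k I))"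
  shows "(\<integral>\<^sup>+Y. h ((\<lambda>i\<in>I. Y i + Y k * q i)(k := Y k)) \<partial>coords (insert k I)) = (\<integral>\<^sup>+Y. h Y \<partial>coords (insert k I))"
proof -
  have upd: "(\<lambda>i\<in>I. (Y(k := t)) i + (Y(k := t)) k * q i)(k := (Y(k := t)) k) = (\<lambda>i\<in>I. t * q i + 1 * Y i)(k := t)" for Y t
    by (auto simp: fun_eq_iff restrict_def)
  have "(\<integral>\<^sup>+Y. h ((\<lambda>i\<in>I. Y i + Y k * q i)(k := Y k)) \<partial>coords (insert k I)) =
     (\<integral>\<^sup>+t. (\<integral>\<^sup>+Y. h ((\<lambda>i\<in>I. t * q i + 1 * Y i)(k := t)) \<partial>coords I) \<partial>lborel)"
    by (subst coords.product_nn_integral_insert_rev, simp, simp, measurable) (simp only: upd)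
  also have "\<dots> = (\<integral>\<^sup>+t. (\<integral>\<^sup>+Y. h (Y(k := t)) \<partial>coords I) \<partial>lborel)"
  proof (rule nn_integral_cong)
    fix t :: real
    show "(\<integral>\<^sup>+Y. h ((\<lambda>i\<in>I. t * q i + 1 * Y i)(k := t)) \<partial>coords I) = (\<integral>\<^sup>+Y. h (Y(k := t)) \<partial>coords I)"
      using nn_integral_coords_affine[of I 1 "\<lambda>Y. h (Y(k := t))" "\<lambda>i. t * q i"] by simp
  qed
  also have "\<dots> = (\<integral>\<^sup>+Y. h Y \<partial>coords (insert k I))"
    by (rule coords.product_nn_integral_insert_rev[symmetric]) auto
  finally show ?thesis .
qed

section \<open>The constants and their recursion\<close>

text \<open>The constant $\kappa$ of the theorem, for the exponent \<open>s\<close> and the dimension \<open>card I\<close>; the positive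
part in the kernel restricts the integral to the unit ball.\<close>

definition ball_const :: "'i set \<Rightarrow> real \<Rightarrow> ennreal" where
  "ball_const I s = (\<integral>\<^sup>+x. pos_powr (s / 2) (1 - ip I x x) \<partial>coords I)"

lemma nn_integral_even:
  fixes h :: "real \<Rightarrow> ennreal"
  assumes [measurable]: "h \<in> borel_measurable borel" and even: "\<And>t. h (- t) = h t"
  shows "(\<integral>\<^sup>+t. h t \<partial>lborel) = 2 * (\<integral>\<^sup>+t. h t * indicator {0<..} t \<partial>lborel)"
proof -
  have "(\<integral>\<^sup>+t. h t \<partial>lborel) = (\<integral>\<^sup>+t. h t * indicator {0<..} t + h t * indicator {..<0} t \<partial>lborel)"
  proof (rule nn_integral_cong_AE)
    have "AE t in lborel. t \<noteq> (0::real)" by (rule AE_lborel_singleton)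
    then show "AE t in lborel. h t = h t * indicator {0<..} t + h t * indicator {..<0} t"
      by eventually_elim (auto simp: indicator_def)
  qed
  also have "\<dots> = (\<integral>\<^sup>+t. h t * indicator {0<..} t \<partial>lborel) + (\<integral>\<^sup>+t. h t * indicator {..<0} t \<partial>lborel)"
    by (rule nn_integral_add) measurable
  also have "(\<integral>\<^sup>+t. h t * indicator {..<0} t \<partial>lborel) = (\<integral>\<^sup>+t. h t * indicator {0<..} t \<partial>lborel)"
    by (subst nn_integral_real_affine[of _ "-1" 0]) (auto simp: even indicator_def intro!: nn_integral_cong)
  finally show ?thesis by (simp add: mult_2)
qed

lemma ball_const_empty: "ball_const {} s = 1"
  by (simp add: ball_const_def coords.nn_integral_empty PiM_empty ip_def pos_powr_def)

lemma ball_const_insert: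
  assumes [simp]: "finite I" "k \<notin> I" and s: "s > 0"
  shows "ball_const (insert k I) s = 2 * half_line_const s * ball_const I (s + 1)"
proof -
  have "ball_const (insert k I) s = (\<integral>\<^sup>+x. (\<integral>\<^sup>+t. pos_powr (s / 2) ((1 - ip I x x) - t\<^sup>2) \<partial>lborel) \<partial>coords I)"
    unfolding ball_const_def
    by (subst coords.product_nn_integral_insert) (auto simp: ip_insert power2_eq_square diff_diff_add)
  also have "\<dots> = (\<integral>\<^sup>+x. 2 * half_line_const s * pos_powr ((s + 1) / 2) (1 - ip I x x) \<partial>coords I)"
    by (intro nn_integral_cong) (subst nn_integral_even, auto simp: half_line_const_scale[OF s] mult.assoc mult.left_commute mult.commute[of _ "half_line_const s"])
  also have "\<dots> = 2 * half_line_const s * ball_const I (s + 1)"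
    unfolding ball_const_def by (rule nn_integral_cmult) measurable
  finally show ?thesis .
qed

lemma ball_const_finite:
  assumes "finite I" "s > 0"
  shows "ball_const I s < \<infinity>"
  using assms
proof (induction I arbitrary: s rule: finite_induct)
  case (insert k I)
  then show ?case
    using insert.IH[of "s + 1"] half_line_const_finite[of s] by (simp add: ball_const_insert ennreal_mult_less_top)
qed (simp add: ball_const_empty)

section \<open>One side of a hyperplane\<close>

text \<open>The form of the inequality that the induction carries: the polar kernel is taken at the barycentre
of \<open>F\<close>, so that no point has to be chosen, and \<open>G\<close> is any function dominated by the polar of \<open>F\<close>.
The regularity asked of \<open>F\<close> is a bounded support, because this property passes to marginals and makes the
barycentre meaningful. The values are in \<open>ennreal\<close> because a marginal can be infinite on a null set.\<close>

definition centred_santalo :: "'i set \<Rightarrow> real \<Rightarrow> bool" where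
  "centred_santalo I s \<longleftrightarrow> (\<forall>F G R.
     F \<in> borel_measurable (coords I) \<longrightarrow> G \<in> borel_measurable (coords I) \<longrightarrow>
     (\<forall>x\<in>space (coords I). F x \<noteq> 0 \<longrightarrow> (\<forall>i\<in>I. \<bar>x i\<bar> \<le> R)) \<longrightarrow>
     (\<integral>\<^sup>+x. F x \<partial>coords I) < \<infinity> \<longrightarrow>
     (\<forall>i\<in>I. (LINT x|density (coords I) F. x i) = 0) \<longrightarrow>
     (\<forall>x\<in>space (coords I). \<forall>y\<in>space (coords I). F x * G y \<le> pos_powr s (1 - ip I x y)) \<longrightarrow>
     (\<integral>\<^sup>+x. F x \<partial>coords I) * (\<integral>\<^sup>+x. G x \<partial>coords I) \<le> (ball_const I s)\<^sup>2)"

lemma ennreal_inverse_mult_cancel: "(C::ennreal) \<noteq> 0 \<Longrightarrow> C < \<infinity> \<Longrightarrow> inverse C * (C * x) = x"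
  by (simp add: mult.assoc[symmetric] mult.commute[of "inverse C"] divide_ennreal_def[symmetric] ennreal_divide_self)

text \<open>The inequality is homogeneous in \<open>G\<close>, so a constant in front of the kernel can be carried along.\<close>

lemma centred_santaloD:
  assumes Q: "centred_santalo I s"
    and [measurable]: "F \<in> borel_measurable (coords I)" "G \<in> borel_measurable (coords I)"
    and R: "\<And>x i. x \<in> space (coords I) \<Longrightarrow> F x \<noteq> 0 \<Longrightarrow> i \<in> I \<Longrightarrow> \<bar>x i\<bar> \<le> R"
    and fin: "(\<integral>\<^sup>+x. F x \<partial>coords I) < \<infinity>"
    and bary: "\<And>i. i \<in> I \<Longrightarrow> (LINT x|density (coords I) F. x i) = 0"
    and C: "C \<noteq> 0" "C < \<infinity>"
    and le: "\<And>x y. x \<in> space (coords I) \<Longrightarrow> y \<in> space (coords I) \<Longrightarrow> F x * G y \<le> C * pos_powr s (1 - ip I x y)"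
  shows "(\<integral>\<^sup>+x. F x \<partial>coords I) * (\<integral>\<^sup>+x. G x \<partial>coords I) \<le> C * (ball_const I s)\<^sup>2"
proof -
  have "(\<integral>\<^sup>+x. F x \<partial>coords I) * (\<integral>\<^sup>+x. inverse C * G x \<partial>coords I) \<le> (ball_const I s)\<^sup>2"
  proof -
    have "F x * (inverse C * G y) \<le> pos_powr s (1 - ip I x y)" if "x \<in> space (coords I)" "y \<in> space (coords I)" for x y
    proof -
      have "F x * (inverse C * G y) = inverse C * (F x * G y)" by (simp add: mult_ac)
      also have "\<dots> \<le> inverse C * (C * pos_powr s (1 - ip I x y))" by (intro mult_left_mono le that) auto
      finally show ?thesis using C by (simp add: ennreal_inverse_mult_cancel)
    qed
    then show ?thesis
      using Q[unfolded centred_santalo_def, rule_format, of F "\<lambda>y. inverse C * G y" R] R fin bary by auto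
  qed
  then have "C * ((\<integral>\<^sup>+x. F x \<partial>coords I) * (inverse C * (\<integral>\<^sup>+x. G x \<partial>coords I))) \<le> C * (ball_const I s)\<^sup>2"
    by (intro mult_left_mono) (simp_all add: nn_integral_cmult)
  moreover have "C * ((\<integral>\<^sup>+x. F x \<partial>coords I) * (inverse C * (\<integral>\<^sup>+x. G x \<partial>coords I))) =
     inverse C * (C * ((\<integral>\<^sup>+x. F x \<partial>coords I) * (\<integral>\<^sup>+x. G x \<partial>coords I)))" by (simp add: mult_ac)
  ultimately show ?thesis using C by (simp add: ennreal_inverse_mult_cancel)
qed

text \<open>Fubini for the oblique coordinates \<open>x = z + y + e t v\<close>, where \<open>y\<close> ranges over the coordinate
hyperplane, the \<open>k\<close>-th coordinate of the direction \<open>v\<close> is taken to be \<open>1\<close>, and \<open>t > 0\<close>. These coordinates are a shear, hence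
measure preserving by translation invariance in each slice.\<close>

lemma halfspace_slice:
  fixes z v :: "'i \<Rightarrow> real"
  assumes [simp]: "finite I" "k \<notin> I" and e: "e = 1 \<or> e = (-1::real)"
    and [measurable]: "h \<in> borel_measurable (coords (insert k I))"
  shows "(\<integral>\<^sup>+x. h x * indicator {x. e * (x k - z k) > 0} x \<partial>coords (insert k I)) =
     (\<integral>\<^sup>+y. (\<integral>\<^sup>+t. h ((\<lambda>i\<in>I. z i + e * t * v i + y i)(k := z k + e * t)) * indicator {0<..} t \<partial>lborel) \<partial>coords I)"
proof -
  interpret sigma_finite_measure "coords I"
    by (simp add: coords.sigma_finite)
  have "(\<integral>\<^sup>+x. h x * indicator {x. e * (x k - z k) > 0} x \<partial>coords (insert k I)) =
     (\<integral>\<^sup>+t. (\<integral>\<^sup>+y. h (y(k := t)) * indicator {t. e * (t - z k) > 0} t \<partial>coords I) \<partial>lborel)"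
    by (subst coords.product_nn_integral_insert_rev) (auto simp: indicator_def)
  also have "\<dots> = (\<integral>\<^sup>+t. (\<integral>\<^sup>+y. h (y(k := z k + e * t)) * indicator {0<..} t \<partial>coords I) \<partial>lborel)"
    using e by (subst nn_integral_real_affine[of _ e "z k"])
      (auto simp: indicator_def mult.assoc[symmetric])
  also have "\<dots> = (\<integral>\<^sup>+t. (\<integral>\<^sup>+y. h ((\<lambda>i\<in>I. z i + e * t * v i + y i)(k := z k + e * t)) * indicator {0<..} t \<partial>coords I) \<partial>lborel)"
  proof (rule nn_integral_cong)
    fix t :: real
    show "(\<integral>\<^sup>+y. h (y(k := z k + e * t)) * indicator {0<..} t \<partial>coords I) =
      (\<integral>\<^sup>+y. h ((\<lambda>i\<in>I. z i + e * t * v i + y i)(k := z k + e * t)) * indicator {0<..} t \<partial>coords I)"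
      by (subst nn_integral_coords_affine[of I 1 _ "\<lambda>i. z i + e * t * v i"]) simp_all
  qed
  also have "\<dots> = (\<integral>\<^sup>+y. (\<integral>\<^sup>+t. h ((\<lambda>i\<in>I. z i + e * t * v i + y i)(k := z k + e * t)) * indicator {0<..} t \<partial>lborel) \<partial>coords I)"
  proof -
    interpret pair_sigma_finite "coords I" "lborel :: real measure"
      by (simp add: coords.sigma_finite pair_sigma_finite.intro sigma_finite_lborel)
    show ?thesis by (rule Fubini') measurable
  qed
  finally show ?thesis .
qed

text \<open>The oblique coordinates dual to those of the previous lemma: the new \<open>k\<close>-th coordinate is the inner
product with \<open>v\<close>. With them the pairing of a point with a dual point splits as \<open>ip I y w + t * r\<close>.\<close>

lemma dual_halfspace_slice:
  fixes v :: "'i \<Rightarrow> real"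
  assumes [simp]: "finite I" "k \<notin> I" and e: "e = 1 \<or> e = (-1::real)"
    and [measurable]: "h \<in> borel_measurable (coords (insert k I))"
  shows "(\<integral>\<^sup>+x. h x * indicator {x. e * (x k + ip I x v) > 0} x \<partial>coords (insert k I)) =
     (\<integral>\<^sup>+w. (\<integral>\<^sup>+r. h (w(k := - ip I w v + e * r)) * indicator {0<..} r \<partial>lborel) \<partial>coords I)"
proof -
  have "(\<integral>\<^sup>+x. h x * indicator {x. e * (x k + ip I x v) > 0} x \<partial>coords (insert k I)) =
     (\<integral>\<^sup>+w. (\<integral>\<^sup>+t. h (w(k := t)) * indicator {t. e * (t + ip I w v) > 0} t \<partial>lborel) \<partial>coords I)"
    by (subst coords.product_nn_integral_insert) (auto simp: indicator_def)
  also have "\<dots> = (\<integral>\<^sup>+w. (\<integral>\<^sup>+r. h (w(k := - ip I w v + e * r)) * indicator {0<..} r \<partial>lborel) \<partial>coords I)"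
  proof (rule nn_integral_cong)
    fix w assume [measurable]: "w \<in> space (coords I)"
    show "(\<integral>\<^sup>+t. h (w(k := t)) * indicator {t. e * (t + ip I w v) > 0} t \<partial>lborel) =
      (\<integral>\<^sup>+r. h (w(k := - ip I w v + e * r)) * indicator {0<..} r \<partial>lborel)"
      using e by (subst nn_integral_real_affine[of _ e "- ip I w v"])
        (auto simp: indicator_def mult.assoc[symmetric])
  qed
  finally show ?thesis .
qed

text \<open>The induction step on one side (\<open>e = 1\<close> or \<open>e = -1\<close>) of the hyperplane \<open>x k = z k\<close>. Integrate \<open>f\<close>
along the direction \<open>v\<close> and \<open>g\<close> along the \<open>k\<close>-th axis, over the half-lines on the chosen side. For
fixed base points, the half-line inequality bounds the product of these marginals by the kernel with
exponent \<open>s + 1\<close> in one dimension less. The hypothesis \<open>bary\<close> says that the marginal of \<open>f\<close>, seen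
from \<open>z\<close>, has its barycentre at the origin, which is what the lower-dimensional inequality needs.\<close>

lemma half_space_santalo:
  fixes z v :: "'i \<Rightarrow> real"
  assumes fin [simp]: "finite I" "k \<notin> I" and s: "s > 0" and Q: "centred_santalo I (s + 1)"
    and e: "e = 1 \<or> e = (-1::real)"
    and f [measurable]: "f \<in> borel_measurable (coords (insert k I))"
    and g [measurable]: "g \<in> borel_measurable (coords (insert k I))"
    and R: "\<And>x i. x \<in> space (coords (insert k I)) \<Longrightarrow> f x \<noteq> 0 \<Longrightarrow> i \<in> insert k I \<Longrightarrow> \<bar>x i\<bar> \<le> R"
    and ffin: "(\<integral>\<^sup>+x. f x \<partial>coords (insert k I)) < \<infinity>"
    and bary: "\<And>i. i \<in> I \<Longrightarrow> (LINT x|density (coords (insert k I)) (\<lambda>x. f x * indicator {x. e * (x k - z k) > 0} x).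
        x i - z i - (x k - z k) * v i) = 0"
    and le: "\<And>x y. x \<in> space (coords (insert k I)) \<Longrightarrow> y \<in> space (coords (insert k I)) \<Longrightarrow>
       f (\<lambda>i\<in>insert k I. z i + x i) * g y \<le> pos_powr s (1 - ip (insert k I) x y)"
  shows "(\<integral>\<^sup>+x. f x * indicator {x. e * (x k - z k) > 0} x \<partial>coords (insert k I)) *
         (\<integral>\<^sup>+y. g y * indicator {y. e * (y k + ip I y v) > 0} y \<partial>coords (insert k I))
     \<le> (half_line_const s)\<^sup>2 * (ball_const I (s + 1))\<^sup>2"
proof -
  let ?J = "insert k I"
  define E where "E y t = (\<lambda>i\<in>I. z i + e * t * v i + y i)(k := z k + e * t)" for y :: "'i \<Rightarrow> real" and t
  define D where "D w r = w(k := - ip I w v + e * r)" for w :: "'i \<Rightarrow> real" and r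
  define F where "F y = (\<integral>\<^sup>+t. f (E y t) * indicator {0<..} t \<partial>lborel)" for y
  define G where "G w = (\<integral>\<^sup>+r. g (D w r) * indicator {0<..} r \<partial>lborel)" for w
  have ee: "e * e = 1" using e by auto
  have E_space: "E y t \<in> space (coords ?J)" for y t
    unfolding E_def by (auto simp: space_PiM PiE_iff extensional_def)
  have D_space: "D w r \<in> space (coords ?J)" if "w \<in> space (coords I)" for w r
    using that unfolding D_def by (auto simp: space_PiM PiE_iff extensional_def)
  have [measurable]: "F \<in> borel_measurable (coords I)" "G \<in> borel_measurable (coords I)"
    unfolding F_def[abs_def] G_def[abs_def] E_def D_def by measurable
  define T where "T x = (\<lambda>i\<in>I. x i - z i - (x k - z k) * v i)" for x :: "'i \<Rightarrow> real"
  have T_meas [measurable]: "T \<in> measurable (coords ?J) (coords I)"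
    unfolding T_def[abs_def] by measurable
  have TE: "T (E y t) = y" if "y \<in> space (coords I)" for y t
    using that fin unfolding T_def E_def
    by (auto simp: space_PiM PiE_iff extensional_def fun_eq_iff restrict_def)
  let ?h = "\<lambda>x. f x * indicator {x. e * (x k - z k) > 0} x"
  have slice: "(\<integral>\<^sup>+x. h x * indicator {x. e * (x k - z k) > 0} x \<partial>coords ?J) =
     (\<integral>\<^sup>+y. (\<integral>\<^sup>+t. h (E y t) * indicator {0<..} t \<partial>lborel) \<partial>coords I)"
    if "h \<in> borel_measurable (coords ?J)" for h
    unfolding E_def by (rule halfspace_slice[OF fin e that])
  have F_int: "(\<integral>\<^sup>+y. F y \<partial>coords I) = (\<integral>\<^sup>+x. ?h x \<partial>coords ?J)"
    unfolding F_def by (rule slice[symmetric]) measurable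
  have G_int: "(\<integral>\<^sup>+y. G y \<partial>coords I) = (\<integral>\<^sup>+y. g y * indicator {y. e * (y k + ip I y v) > 0} y \<partial>coords ?J)"
    unfolding G_def D_def by (rule dual_halfspace_slice[OF fin e g, symmetric])
  have hm [measurable]: "?h \<in> borel_measurable (coords ?J)"
    by measurable
  have marg: "density (coords I) F = distr (density (coords ?J) ?h) (coords I) T"
  proof (rule measure_eqI)
    fix A assume A [measurable]: "A \<in> sets (density (coords I) F)"
    then have [measurable]: "A \<in> sets (coords I)" by simp
    have "emeasure (distr (density (coords ?J) ?h) (coords I) T) A =
      (\<integral>\<^sup>+x. ?h x * indicator (T -` A \<inter> space (coords ?J)) x \<partial>coords ?J)"
      by (subst emeasure_distr) (auto simp: emeasure_density)
    also have "\<dots> = (\<integral>\<^sup>+x. (f x * indicator A (T x)) * indicator {x. e * (x k - z k) > 0} x \<partial>coords ?J)"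
      by (intro nn_integral_cong) (auto simp: indicator_def)
    also have "\<dots> = (\<integral>\<^sup>+y. (\<integral>\<^sup>+t. f (E y t) * indicator A (T (E y t)) * indicator {0<..} t \<partial>lborel) \<partial>coords I)"
      by (rule slice) measurable
    also have "\<dots> = (\<integral>\<^sup>+y. F y * indicator A y \<partial>coords I)"
    proof (rule nn_integral_cong)
      fix y assume y: "y \<in> space (coords I)"
      show "(\<integral>\<^sup>+t. f (E y t) * indicator A (T (E y t)) * indicator {0<..} t \<partial>lborel) = F y * indicator A y"
        unfolding TE[OF y] F_def by (auto simp: indicator_def)
    qed
    also have "\<dots> = emeasure (density (coords I) F) A"
      by (subst emeasure_density) auto
    finally show "emeasure (density (coords I) F) A = emeasure (distr (density (coords ?J) ?h) (coords I) T) A" ..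
  qed simp
  have hb: "half_line_const s \<noteq> 0" "half_line_const s < \<infinity>" by (rule half_line_const_nonzero, rule half_line_const_finite[OF s])
  have "(\<integral>\<^sup>+x. F x \<partial>coords I) * (\<integral>\<^sup>+x. G x \<partial>coords I) \<le> (half_line_const s)\<^sup>2 * (ball_const I (s + 1))\<^sup>2"
  proof (rule centred_santaloD[OF Q])
    show "(\<integral>\<^sup>+x. F x \<partial>coords I) < \<infinity>"
      unfolding F_int by (rule le_less_trans[OF nn_integral_mono ffin]) (auto simp: indicator_def)
    show "(half_line_const s)\<^sup>2 \<noteq> 0" "(half_line_const s)\<^sup>2 < \<infinity>" using hb by (auto simp: power2_eq_square ennreal_mult_less_top)
    show "(LINT x|density (coords I) F. x i) = 0" if i: "i \<in> I" for i
    proof -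
      have "(LINT x|density (coords I) F. x i) = (LINT x|density (coords ?J) ?h. T x i)"
        unfolding marg by (rule integral_distr) (use i in measurable)
      also have "\<dots> = 0" using bary[OF i] i by (simp add: T_def)
      finally show ?thesis .
    qed
    fix y assume y: "y \<in> space (coords I)"
    show "\<bar>y i\<bar> \<le> R + (\<Sum>i\<in>I. \<bar>z i\<bar>) + (R + \<bar>z k\<bar>) * (\<Sum>i\<in>I. \<bar>v i\<bar>)" if F0: "F y \<noteq> 0" and i: "i \<in> I" for i
    proof -
      have "\<exists>t. f (E y t) \<noteq> 0"
      proof (rule ccontr)
        assume "\<not> (\<exists>t. f (E y t) \<noteq> 0)"
        then have "F y = 0" unfolding F_def by simp
        then show False using F0 by simp
      qed
      then obtain t where t: "f (E y t) \<noteq> 0" by auto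
      have ik: "i \<noteq> k" using i fin by auto
      have 1: "\<bar>z k + e * t\<bar> \<le> R" using R[OF E_space t, of k] by (simp add: E_def)
      have 2: "\<bar>z i + e * t * v i + y i\<bar> \<le> R" using R[OF E_space t, of i] i ik by (auto simp: E_def)
      have "\<bar>e * t\<bar> \<le> R + \<bar>z k\<bar>" using 1 by linarith
      then have "\<bar>e * t * v i\<bar> \<le> (R + \<bar>z k\<bar>) * \<bar>v i\<bar>" unfolding abs_mult[of "e * t"] by (rule mult_right_mono) simp
      also have "\<dots> \<le> (R + \<bar>z k\<bar>) * (\<Sum>i\<in>I. \<bar>v i\<bar>)"
        using member_le_sum[OF i, of "\<lambda>i. \<bar>v i\<bar>"] 1 by (intro mult_left_mono) auto
      finally have 3: "\<bar>e * t * v i\<bar> \<le> (R + \<bar>z k\<bar>) * (\<Sum>i\<in>I. \<bar>v i\<bar>)" .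
      have "\<bar>z i\<bar> \<le> (\<Sum>i\<in>I. \<bar>z i\<bar>)" using member_le_sum[OF i, of "\<lambda>i. \<bar>z i\<bar>"] by simp
      then show ?thesis using 2 3 by linarith
    qed
    fix w assume w: "w \<in> space (coords I)"
    have "F y * G w \<le> (\<integral>\<^sup>+t. pos_powr (s / 2) ((1 - ip I y w) - t\<^sup>2) * indicator {0<..} t \<partial>lborel)\<^sup>2"
      unfolding F_def G_def
    proof (rule half_line_santalo)
      show "(\<lambda>t. f (E y t)) \<in> borel_measurable borel" "(\<lambda>r. g (D w r)) \<in> borel_measurable borel"
        using y w unfolding E_def D_def by measurable
      fix t r :: real
      define x where "x = (\<lambda>i\<in>I. e * t * v i + y i)(k := e * t)"
      have xs: "x \<in> space (coords ?J)"
        unfolding x_def by (auto simp: space_PiM PiE_iff extensional_def)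
      have Ex: "E y t = (\<lambda>i\<in>?J. z i + x i)"
        using fin unfolding E_def x_def by (auto simp: fun_eq_iff restrict_def)
      have "ip ?J x (D w r) = ip I (\<lambda>i. e * t * v i + y i) w + e * t * (- ip I w v + e * r)"
        unfolding x_def D_def by (subst ip_insert) auto
      also have "\<dots> = ip I y w + t * r"
        unfolding ip_add ip_scale ip_commute[of I w v] using ee by (simp add: algebra_simps)
      finally have eq: "ip ?J x (D w r) = ip I y w + t * r" .
      show "f (E y t) * g (D w r) \<le> pos_powr s (1 - ip I y w - t * r)"
        using le[OF xs D_space[OF w, of r]] unfolding Ex eq by (simp add: diff_diff_add)
    qed
    also have "\<dots> = (half_line_const s)\<^sup>2 * (pos_powr ((s + 1) / 2) (1 - ip I y w) * pos_powr ((s + 1) / 2) (1 - ip I y w))"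
      unfolding half_line_const_scale[OF s] by (simp add: power2_eq_square mult_ac)
    finally show "F y * G w \<le> (half_line_const s)\<^sup>2 * pos_powr (s + 1) (1 - ip I y w)"
      unfolding pos_powr_half .
  qed measurable
  then show ?thesis unfolding F_int G_int .
qed

section \<open>The Santalo point on a hyperplane\<close>

lemma integral_pos_of_AE_pos:
  fixes h :: "'a \<Rightarrow> real"
  assumes "finite_measure N" "integrable N h" "AE x in N. 0 < h x" "emeasure N (space N) \<noteq> 0"
  shows "0 < integral\<^sup>L N h"
  using finite_measure.integral_less_AE_space[of N "\<lambda>_. 0" h] assms by simp

lemma density_AE_nonzero:
  assumes "f \<in> borel_measurable M" "\<And>x. x \<in> space M \<Longrightarrow> f x \<noteq> 0 \<Longrightarrow> P x"
  shows "AE x in density M f. P x"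
  using assms by (subst AE_density) (auto simp: zero_less_iff_neq_zero)

text \<open>The point \<open>z\<close> is where the segment between the barycentres of \<open>f\<close> on the two sides of the hyperplane
crosses the hyperplane, and \<open>v\<close> below is the direction of this segment. Seen along \<open>v\<close> from \<open>z\<close>, both
halves of \<open>f\<close> have barycentre \<open>0\<close>, so the one-sided step applies on both sides with the same \<open>z\<close>
and \<open>v\<close>; the dual half-spaces on the two sides of the hyperplane orthogonal to \<open>v\<close> carry all of
\<open>g\<close>. Adding the two estimates gives the factor
$\frac14\left(\frac1\lambda+\frac1{1-\lambda}\right) = \frac1{4\lambda(1-\lambda)}$.
The second property of \<open>z\<close> holds because \<open>z\<close> is an average of points of the support of \<open>f\<close>; it
keeps \<open>1 - ip J x z\<close> positive in the projective change of variables that moves the centre to \<open>z\<close>.\<close>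

lemma hyperplane_santalo:
  fixes f :: "('i \<Rightarrow> real) \<Rightarrow> ennreal"
  assumes fin [simp]: "finite I" "k \<notin> I" and s: "s > 0" and Q: "centred_santalo I (s + 1)"
    and f [measurable]: "f \<in> borel_measurable (coords (insert k I))"
    and R: "\<forall>x\<in>space (coords (insert k I)). f x \<noteq> 0 \<longrightarrow> (\<forall>i\<in>insert k I. \<bar>x i\<bar> \<le> R)"
    and M: "(\<integral>\<^sup>+x. f x \<partial>coords (insert k I)) = M" "0 < M" "M < \<infinity>"
    and lam: "0 < lam" "lam < 1"
    and upper: "(\<integral>\<^sup>+x. f x * indicator {x. x k > c} x \<partial>coords (insert k I)) = ennreal lam * M"
    and lower: "(\<integral>\<^sup>+x. f x * indicator {x. x k < c} x \<partial>coords (insert k I)) = ennreal (1 - lam) * M"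
  obtains z where "z k = c"
    and "\<And>x. (\<And>w. w \<in> space (coords (insert k I)) \<Longrightarrow> f w \<noteq> 0 \<Longrightarrow> ip (insert k I) x w < 1) \<Longrightarrow> ip (insert k I) x z < 1"
    and "\<And>g. g \<in> borel_measurable (coords (insert k I)) \<Longrightarrow>
      (\<And>x y. x \<in> space (coords (insert k I)) \<Longrightarrow> y \<in> space (coords (insert k I)) \<Longrightarrow>
         f (\<lambda>i\<in>insert k I. z i + x i) * g y \<le> pos_powr s (1 - ip (insert k I) x y)) \<Longrightarrow>
      M * (\<integral>\<^sup>+y. g y \<partial>coords (insert k I)) \<le> ennreal (1 / (4 * lam * (1 - lam))) * (ball_const (insert k I) s)\<^sup>2"
proof -
  let ?J = "insert k I"
  define S where "S e = {x. e * (x k - c) > 0}" for e and x :: "'i \<Rightarrow> real"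
  have S_upper: "S 1 = {x :: 'i \<Rightarrow> real. x k > c}" and S_lower: "S (-1) = {x :: 'i \<Rightarrow> real. x k < c}"
    unfolding S_def by auto
  have fS [measurable]: "(\<lambda>x. f x * indicator (S e) x) \<in> borel_measurable (coords ?J)" for e
    unfolding S_def by measurable
  define N where "N e = density (coords ?J) (\<lambda>x. f x * indicator (S e) x)" for e
  have N_AE: "AE x in N e. P x" if "\<And>x. x \<in> space (coords ?J) \<Longrightarrow> f x \<noteq> 0 \<Longrightarrow> x \<in> S e \<Longrightarrow> P x" for P e
    unfolding N_def using that by (intro density_AE_nonzero[OF fS]) (auto simp: indicator_def split: if_splits)
  have N_space: "emeasure (N e) (space (N e)) = (\<integral>\<^sup>+x. f x * indicator (S e) x \<partial>coords ?J)" for e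
    unfolding N_def by (subst emeasure_density) (auto intro!: nn_integral_cong)
  have N_fin: "finite_measure (N e)" for e
  proof (rule finite_measureI)
    have "emeasure (N e) (space (N e)) \<le> M"
      unfolding N_space M(1)[symmetric] by (intro nn_integral_mono) (auto simp: indicator_def)
    then show "emeasure (N e) (space (N e)) \<noteq> \<infinity>" using M(3) by auto
  qed
  have N_sets [measurable_cong]: "sets (N e) = sets (coords ?J)" for e unfolding N_def by simp
  have N_coord: "integrable (N e) (\<lambda>x. x i)" if "i \<in> ?J" for i e
  proof -
    interpret finite_measure "N e" by (rule N_fin)
    show ?thesis
      by (rule integrable_const_bound[where B = R], rule N_AE) (use that R in \<open>auto\<close>)
  qed
  have N_const: "integrable (N e) (\<lambda>x. a)" for e and a :: real
  proof -
    interpret finite_measure "N e" by (rule N_fin)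
    show ?thesis by simp
  qed
  define m where "m e = measure (N e) (space (N e))" for e
  define X where "X e i = (LINT x|N e. x i)" for e i
  define T where "T e = e * (X e k - c * m e)" for e
  have m_up: "ennreal (m 1) = ennreal lam * M" and m_lo: "ennreal (m (-1)) = ennreal (1 - lam) * M"
    unfolding m_def using finite_measure.emeasure_eq_measure[OF N_fin] N_space S_upper S_lower upper lower by metis+
  have N_nz: "emeasure (N e) (space (N e)) \<noteq> 0" if "e = 1 \<or> e = -1" for e
    using that N_space[of e] upper lower S_upper S_lower M(2) lam by (auto simp: ennreal_eq_0_iff)
  have m_pos: "m e > 0" if "e = 1 \<or> e = -1" for e
    using N_nz[OF that] unfolding m_def finite_measure.emeasure_eq_measure[OF N_fin] by (simp add: zero_less_measure_iff)
  have T_pos: "T e > 0" if "e = 1 \<or> e = -1" for e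
  proof -
    have "0 < (LINT x|N e. e * (x k - c))"
      by (intro integral_pos_of_AE_pos N_fin N_nz[OF that] N_AE) (auto simp: S_def intro!: Bochner_Integration.integrable_diff N_coord N_const)
    also have "\<dots> = T e" unfolding T_def X_def m_def
      by (simp add: N_coord N_const)
    finally show ?thesis .
  qed
  have pos: "m 1 > 0" "m (-1) > 0" "T 1 > 0" "T (-1) > 0" using m_pos T_pos by auto
  \<comment> \<open>The conditions \<open>z i * m e + e * T e * v i = X e i\<close> for both sides are a linear system in
    \<open>z i\<close> and \<open>v i\<close> with determinant \<open>- D\<close>; the formulas below are Cramer's rule.\<close>
  define D where "D = m 1 * T (-1) + m (-1) * T 1"
  have D: "D > 0" unfolding D_def using pos by (intro add_pos_pos mult_pos_pos)
  define v where "v i = (X 1 i * m (-1) - X (-1) i * m 1) / D" for i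
  define z where "z i = (X 1 i * T (-1) + X (-1) i * T 1) / D" for i
  have zk: "z k = c"
  proof -
    have Xk: "X 1 k = T 1 + c * m 1" "X (-1) k = c * m (-1) - T (-1)" unfolding T_def by auto
    have "X 1 k * T (-1) + X (-1) k * T 1 = c * D" unfolding D_def Xk by (simp add: algebra_simps)
    then show ?thesis unfolding z_def using D by simp
  qed
  have bary: "(LINT x|N e. x i - z i - (x k - z k) * v i) = 0" if i: "i \<in> I" and e: "e = 1 \<or> e = -1" for i e
  proof -
    have "(LINT x|N e. x i - z i - (x k - z k) * v i) = X e i - z i * m e - (X e k - c * m e) * v i"
      using i unfolding X_def m_def zk
      by (simp add: N_coord N_const Bochner_Integration.integral_diff Bochner_Integration.integrable_diff)
    also have "\<dots> = X e i - z i * m e - e * T e * v i" using e unfolding T_def by auto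
    also have "\<dots> = (X e i * D - (X 1 i * T (-1) + X (-1) i * T 1) * m e - e * T e * (X 1 i * m (-1) - X (-1) i * m 1)) / D"
      unfolding z_def v_def using D by (simp add: field_simps)
    also have "\<dots> = 0" using e unfolding D_def by (auto simp: algebra_simps)
    finally show ?thesis .
  qed
  show thesis
  proof (rule that[of z, OF zk])
    fix x assume x: "\<And>w. w \<in> space (coords ?J) \<Longrightarrow> f w \<noteq> 0 \<Longrightarrow> ip ?J x w < 1"
    have pos': "0 < m e - (\<Sum>i\<in>?J. x i * X e i)" if "e = 1 \<or> e = -1" for e
    proof -
      have int: "integrable (N e) (\<lambda>w. ip ?J x w)"
        unfolding ip_def by (intro Bochner_Integration.integrable_sum integrable_mult_right N_coord)
      have "0 < (LINT w|N e. 1 - ip ?J x w)"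
        by (intro integral_pos_of_AE_pos N_fin N_nz[OF that] N_AE Bochner_Integration.integrable_diff N_const int) (use x in auto)
      also have "\<dots> = m e - (LINT w|N e. ip ?J x w)"
        by (subst Bochner_Integration.integral_diff[OF N_const int]) (simp add: m_def)
      also have "(LINT w|N e. ip ?J x w) = (\<Sum>i\<in>?J. x i * X e i)"
        unfolding ip_def X_def by (subst Bochner_Integration.integral_sum) (auto intro!: integrable_mult_right N_coord sum.cong)
      finally show ?thesis .
    qed
    have "ip ?J x z * D = (\<Sum>i\<in>?J. x i * X 1 i) * T (-1) + (\<Sum>i\<in>?J. x i * X (-1) i) * T 1"
      unfolding ip_def z_def sum_distrib_right sum.distrib[symmetric]
      using D by (intro sum.cong) (auto simp: field_simps)
    also have "\<dots> < m 1 * T (-1) + m (-1) * T 1"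
      using pos' pos by (intro add_strict_mono mult_strict_right_mono) auto
    finally have "ip ?J x z * D < 1 * D" unfolding D_def by simp
    then show "ip ?J x z < 1" using D by (simp only: mult_less_cancel_right_pos)
  next
    fix g :: "('i \<Rightarrow> real) \<Rightarrow> ennreal"
    assume g [measurable]: "g \<in> borel_measurable (coords ?J)"
      and le: "\<And>x y. x \<in> space (coords ?J) \<Longrightarrow> y \<in> space (coords ?J) \<Longrightarrow>
         f (\<lambda>i\<in>?J. z i + x i) * g y \<le> pos_powr s (1 - ip ?J x y)"
    define B where "B = (half_line_const s)\<^sup>2 * (ball_const I (s + 1))\<^sup>2"
    define A where "A e = (\<integral>\<^sup>+y. g y * indicator {y. e * (y k + ip I y v) > 0} y \<partial>coords ?J)" for e
    have half: "(\<integral>\<^sup>+x. f x * indicator (S e) x \<partial>coords ?J) * A e \<le> B" if e: "e = 1 \<or> e = -1" for e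
    proof -
      have SS: "S e = {x. e * (x k - z k) > 0}" unfolding S_def zk ..
      show ?thesis
        unfolding B_def A_def SS
      proof (rule half_space_santalo[where f = f and g = g and z = z and v = v, OF fin s Q e f g])
        show "(\<integral>\<^sup>+x. f x \<partial>coords ?J) < \<infinity>" using M by simp
        show "(LINT x|density (coords ?J) (\<lambda>x. f x * indicator {x. e * (x k - z k) > 0} x).
            x i - z i - (x k - z k) * v i) = 0" if "i \<in> I" for i
          using bary[OF that e] unfolding N_def SS .
      qed (use R le in auto)
    qed
    have split: "(\<integral>\<^sup>+y. g y \<partial>coords ?J) \<le> A 1 + A (-1)"
    proof -
      have "(\<integral>\<^sup>+y. g y \<partial>coords ?J) = (\<integral>\<^sup>+y. (\<integral>\<^sup>+t. g (y(k := t)) \<partial>lborel) \<partial>coords I)"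
        by (rule coords.product_nn_integral_insert) auto
      also have "\<dots> \<le> (\<integral>\<^sup>+y. (\<integral>\<^sup>+t. g (y(k := t)) * indicator {y. 1 * (y k + ip I y v) > 0} (y(k := t))
          + g (y(k := t)) * indicator {y. (-1) * (y k + ip I y v) > 0} (y(k := t)) \<partial>lborel) \<partial>coords I)"
      proof (rule nn_integral_mono, rule nn_integral_mono_AE)
        fix y :: "'i \<Rightarrow> real"
        have "AE t in lborel. t \<noteq> - ip I y v" by (rule AE_lborel_singleton)
        then show "AE t in lborel. g (y(k := t)) \<le> g (y(k := t)) * indicator {y. 1 * (y k + ip I y v) > 0} (y(k := t))
          + g (y(k := t)) * indicator {y. (-1) * (y k + ip I y v) > 0} (y(k := t))"
          by eventually_elim (auto simp: indicator_def)
      qed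
      also have "\<dots> = (\<integral>\<^sup>+y. g y * indicator {y. 1 * (y k + ip I y v) > 0} y
          + g y * indicator {y. (-1) * (y k + ip I y v) > 0} y \<partial>coords ?J)"
        by (rule coords.product_nn_integral_insert[symmetric]) auto
      also have "\<dots> = A 1 + A (-1)"
        unfolding A_def by (rule nn_integral_add) auto
      finally show ?thesis .
    qed
    have 1: "M * A 1 \<le> ennreal (1 / lam) * B"
    proof -
      have "M * A 1 = ennreal (1 / lam) * (ennreal lam * M * A 1)"
        using lam by (simp add: mult.assoc[symmetric] ennreal_mult[symmetric])
      also have "\<dots> \<le> ennreal (1 / lam) * B"
        using half[of 1] unfolding S_upper upper by (intro mult_left_mono) auto
      finally show ?thesis .
    qed
    have 2: "M * A (-1) \<le> ennreal (1 / (1 - lam)) * B"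
    proof -
      have "M * A (-1) = ennreal (1 / (1 - lam)) * (ennreal (1 - lam) * M * A (-1))"
        using lam by (simp add: mult.assoc[symmetric] ennreal_mult[symmetric])
      also have "\<dots> \<le> ennreal (1 / (1 - lam)) * B"
        using half[of "-1"] unfolding S_lower lower by (intro mult_left_mono) auto
      finally show ?thesis .
    qed
    have "M * (\<integral>\<^sup>+y. g y \<partial>coords ?J) \<le> M * A 1 + M * A (-1)"
      using mult_left_mono[OF split, of M] by (simp add: distrib_left)
    also have "\<dots> \<le> ennreal (1 / lam) * B + ennreal (1 / (1 - lam)) * B" by (rule add_mono[OF 1 2])
    also have "\<dots> = ennreal (1 / lam + 1 / (1 - lam)) * B"
      using lam by (subst ennreal_plus) (auto simp: distrib_right)
    also have "1 / lam + 1 / (1 - lam) = 1 / (4 * lam * (1 - lam)) * 4" using lam by (simp add: field_simps)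
    also have "ennreal (1 / (4 * lam * (1 - lam)) * 4) * B = ennreal (1 / (4 * lam * (1 - lam))) * (ball_const ?J s)\<^sup>2"
      unfolding ball_const_insert[OF fin s] B_def using lam
      by (subst ennreal_mult) (auto simp: power_mult_distrib mult.assoc)
    finally show "M * (\<integral>\<^sup>+y. g y \<partial>coords ?J) \<le> ennreal (1 / (4 * lam * (1 - lam))) * (ball_const ?J s)\<^sup>2" .
  qed
qed

section \<open>Changing the centre of polarity\<close>

text \<open>The weight \<open>t powr q\<close> on an interval \<open>{0<..<a}\<close> is an auxiliary radial variable. Only the scaling
behaviour of its integral in \<open>a\<close> matters; the value for \<open>a = 1\<close> cancels in the end.\<close>

lemma truncated_power_scale:
  assumes a: "a > 0"
  shows "(\<integral>\<^sup>+t. ennreal (t powr q) * indicator {0<..<a} t \<partial>lborel) =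
    ennreal (a powr (q + 1)) * (\<integral>\<^sup>+t. ennreal (t powr q) * indicator {0<..<1} t \<partial>lborel)"
proof -
  have "(\<integral>\<^sup>+t. ennreal (t powr q) * indicator {0<..<a} t \<partial>lborel) =
     ennreal \<bar>a\<bar> * (\<integral>\<^sup>+t. ennreal ((0 + a * t) powr q) * indicator {0<..<a} (0 + a * t) \<partial>lborel)"
    by (rule nn_integral_real_affine) (use a in auto)
  also have "(\<integral>\<^sup>+t. ennreal ((0 + a * t) powr q) * indicator {0<..<a} (0 + a * t) \<partial>lborel) =
     (\<integral>\<^sup>+t. ennreal (a powr q) * (ennreal (t powr q) * indicator {0<..<1} t) \<partial>lborel)"
    by (intro nn_integral_cong)
       (use a in \<open>auto simp: indicator_def powr_mult ennreal_mult zero_less_mult_iff\<close>)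
  also have "\<dots> = ennreal (a powr q) * (\<integral>\<^sup>+t. ennreal (t powr q) * indicator {0<..<1} t \<partial>lborel)"
    by (rule nn_integral_cmult) measurable
  finally show ?thesis
    using a by (simp add: mult.assoc[symmetric] ennreal_mult[symmetric] powr_add mult.commute)
qed

lemma truncated_power_nonzero:
  "(\<integral>\<^sup>+t. ennreal (t powr q) * indicator {0<..<1} t \<partial>lborel) \<noteq> 0"
proof
  assume "(\<integral>\<^sup>+t. ennreal (t powr q) * indicator {0<..<1} t \<partial>lborel) = 0"
  then have "AE t in lborel. ennreal (t powr q) * indicator {0<..<1} t = 0"
    by (subst (asm) nn_integral_0_iff_AE) auto
  then have "AE t in lborel. t \<notin> {0<..<1::real}"
    by (elim AE_mp) (auto intro!: AE_I2 simp: indicator_def)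
  then have "emeasure lborel {0<..<1::real} = 0" by (subst (asm) AE_iff_null_sets[symmetric]) auto
  then show False by simp
qed

lemma truncated_power_finite:
  assumes "q \<ge> 0"
  shows "(\<integral>\<^sup>+t. ennreal (t powr q) * indicator {0<..<1} t \<partial>lborel) < \<infinity>"
proof -
  have "(\<integral>\<^sup>+t. ennreal (t powr q) * indicator {0<..<1} t \<partial>lborel) \<le> (\<integral>\<^sup>+t. indicator {0<..<1::real} t \<partial>lborel)"
    using assms by (intro nn_integral_mono) (auto simp: indicator_def powr_le1)
  then show ?thesis by (simp add: le_less_trans)
qed

text \<open>Moving the centre of polarity to \<open>z\<close> replaces \<open>F\<close> by its composition with the projective map
$y \mapsto y/(1+\langle y,z\rangle)$, times a power of the denominator, because
$(1+\langle y,z\rangle)\bigl(1-\langle y',w+z\rangle\bigr)=1-\langle y,w\rangle$ for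
$y'=y/(1+\langle y,z\rangle)$.\<close>

definition projective_pull :: "'i set \<Rightarrow> real \<Rightarrow> ('i \<Rightarrow> real) \<Rightarrow> (('i \<Rightarrow> real) \<Rightarrow> ennreal) \<Rightarrow> ('i \<Rightarrow> real) \<Rightarrow> ennreal" where
  "projective_pull J s z F y =
     (if 0 < 1 + ip J y z then ennreal ((1 + ip J y z) powr s) * F (\<lambda>i\<in>J. y i / (1 + ip J y z)) else 0)"

lemma projective_pull_measurable [measurable]:
  assumes [measurable]: "F \<in> borel_measurable (coords J)"
  shows "projective_pull J s z F \<in> borel_measurable (coords J)"
  unfolding projective_pull_def[abs_def] by measurable

text \<open>The change of variables $y=x/(1-\langle x,z\rangle)$, for which
$dy=(1-\langle x,z\rangle)^{-(d+1)}dx$. Instead of differentiating, add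
a radial variable: on the cone over the space the projective
map becomes the shear \<open>\<sigma> = t + ip J Y z\<close>, and Fubini, scaling and translation invariance give
the formula.\<close>

lemma projective_pull_integral:
  assumes fin: "finite J" and s: "s > 0"
    and F [measurable]: "F \<in> borel_measurable (coords J)"
    and lt: "\<And>x. x \<in> space (coords J) \<Longrightarrow> F x \<noteq> 0 \<Longrightarrow> ip J x z < 1"
  shows "(\<integral>\<^sup>+y. projective_pull J s z F y \<partial>coords J) =
    (\<integral>\<^sup>+x. F x * ennreal ((1 - ip J x z) powr - (s + card J + 1)) \<partial>coords J)"
proof -
  interpret coordsJ: sigma_finite_measure "coords J" by (simp add: coords.sigma_finite fin)
  interpret pair: pair_sigma_finite "coords J" "lborel :: real measure"
    by (simp add: coords.sigma_finite fin pair_sigma_finite.intro sigma_finite_lborel)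
  define d where "d = card J"
  define W where "W = (\<integral>\<^sup>+t. ennreal (t powr (s + d)) * indicator {0<..<1} t \<partial>lborel)"
  define g where "g = projective_pull J s z F"
  have g_meas [measurable]: "g \<in> borel_measurable (coords J)" unfolding g_def by measurable
  have scale: "(\<integral>\<^sup>+x. h (\<lambda>i\<in>J. x i / t) \<partial>coords J) = ennreal (t ^ d) * (\<integral>\<^sup>+x. h x \<partial>coords J)"
    if [measurable]: "h \<in> borel_measurable (coords J)" and t: "t > 0" for h t
  proof -
    have hm: "(\<lambda>x. h (\<lambda>i\<in>J. x i / t)) \<in> borel_measurable (coords J)" by measurable
    have "h (\<lambda>i\<in>J. (\<lambda>i\<in>J. 0 + t * x i) i / t) = h x" if "x \<in> space (coords J)" for x
    proof -
      have "(\<lambda>i\<in>J. (\<lambda>i\<in>J. 0 + t * x i) i / t) = x" using t that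
        by (auto simp: fun_eq_iff restrict_def space_PiM PiE_iff extensional_def)
      then show ?thesis by simp
    qed
    then show ?thesis
      using nn_integral_coords_affine[OF fin, of t "\<lambda>x. h (\<lambda>i\<in>J. x i / t)" "\<lambda>_. 0"] t hm
      by (simp add: d_def cong: nn_integral_cong)
  qed
  \<comment> \<open>The integrand on the cone, homogeneous of degree \<open>s\<close> up to the constraint
    \<open>0 < t < 1\<close> on the original radial variable \<open>t = \<sigma> - ip J Y z\<close>.\<close>
  define U where "U Y \<sigma> = ennreal (\<sigma> powr s) * F (\<lambda>i\<in>J. Y i / \<sigma>) * indicator {0<..} \<sigma> * indicator {0<..<1} (\<sigma> - ip J Y z)" for Y \<sigma>
  have [measurable]: "(\<lambda>(Y, \<sigma>). U Y \<sigma>) \<in> borel_measurable (coords J \<Otimes>\<^sub>M lborel)"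
    unfolding U_def by measurable
  have "W * (\<integral>\<^sup>+y. g y \<partial>coords J) = (\<integral>\<^sup>+t. ennreal (t powr (s + d)) * indicator {0<..<1} t * (\<integral>\<^sup>+y. g y \<partial>coords J) \<partial>lborel)"
    unfolding W_def by (rule nn_integral_multc[symmetric]) measurable
  also have "\<dots> = (\<integral>\<^sup>+t. (\<integral>\<^sup>+Y. U Y (ip J Y z + t) \<partial>coords J) \<partial>lborel)"
  proof (rule nn_integral_cong)
    fix t :: real
    show "ennreal (t powr (s + d)) * indicator {0<..<1} t * (\<integral>\<^sup>+y. g y \<partial>coords J) = (\<integral>\<^sup>+Y. U Y (ip J Y z + t) \<partial>coords J)"
    proof (cases "0 < t \<and> t < 1")
      case True
      have "ennreal (t powr (s + d)) * indicator {0<..<1} t * (\<integral>\<^sup>+y. g y \<partial>coords J)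
         = ennreal (t powr s) * (ennreal (t ^ d) * (\<integral>\<^sup>+y. g y \<partial>coords J))"
        using True by (simp add: powr_add powr_realpow ennreal_mult mult.assoc)
      also have "\<dots> = ennreal (t powr s) * (\<integral>\<^sup>+Y. g (\<lambda>i\<in>J. Y i / t) \<partial>coords J)"
        by (subst scale) (use True in auto)
      also have "\<dots> = (\<integral>\<^sup>+Y. ennreal (t powr s) * g (\<lambda>i\<in>J. Y i / t) \<partial>coords J)"
        by (rule nn_integral_cmult[symmetric]) measurable
      also have "\<dots> = (\<integral>\<^sup>+Y. U Y (ip J Y z + t) \<partial>coords J)"
      proof (rule nn_integral_cong)
        fix Y :: "'a \<Rightarrow> real"
        have ipY: "ip J (\<lambda>i\<in>J. Y i / t) z = ip J Y z / t"
          using ip_scale[of J "1 / t" Y z] by simp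
        have e: "1 + ip J Y z / t = (ip J Y z + t) / t" using True by (simp add: field_simps)
        have e2: "0 < (ip J Y z + t) / t \<longleftrightarrow> 0 < ip J Y z + t"
          using True by (simp add: zero_less_divide_iff)
        show "ennreal (t powr s) * g (\<lambda>i\<in>J. Y i / t) = U Y (ip J Y z + t)"
        proof (cases "0 < ip J Y z + t")
          case True': True
          have "(\<lambda>i\<in>J. (\<lambda>i\<in>J. Y i / t) i / ((ip J Y z + t) / t)) = (\<lambda>i\<in>J. Y i / (ip J Y z + t))"
            using True by (auto simp: fun_eq_iff restrict_def)
          moreover have "t powr s * ((ip J Y z + t) / t) powr s = (ip J Y z + t) powr s"
            using True True' by (simp add: powr_mult[symmetric])
          ultimately show ?thesis
            using True True' unfolding g_def projective_pull_def ipY e e2 U_def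
            by (simp add: mult.assoc[symmetric] ennreal_mult[symmetric])
        next
          case False
          then show ?thesis unfolding g_def projective_pull_def ipY e e2 U_def by simp
        qed
      qed
      finally show ?thesis .
    qed (auto simp: U_def)
  qed
  also have "\<dots> = (\<integral>\<^sup>+Y. (\<integral>\<^sup>+t. U Y (ip J Y z + t) \<partial>lborel) \<partial>coords J)"
    by (rule pair.Fubini') measurable
  also have "\<dots> = (\<integral>\<^sup>+Y. (\<integral>\<^sup>+\<sigma>. U Y \<sigma> \<partial>lborel) \<partial>coords J)"
  proof (rule nn_integral_cong)
    fix Y assume [measurable]: "Y \<in> space (coords J)"
    show "(\<integral>\<^sup>+t. U Y (ip J Y z + t) \<partial>lborel) = (\<integral>\<^sup>+\<sigma>. U Y \<sigma> \<partial>lborel)"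
      using nn_integral_real_affine[of "U Y" 1 "ip J Y z"] by simp
  qed
  also have "\<dots> = (\<integral>\<^sup>+\<sigma>. (\<integral>\<^sup>+Y. U Y \<sigma> \<partial>coords J) \<partial>lborel)"
    by (rule pair.Fubini'[symmetric]) measurable
  also have "\<dots> = (\<integral>\<^sup>+\<sigma>. (\<integral>\<^sup>+x. F x * (ennreal (\<sigma> powr (s + d)) * indicator {0<..<1 / (1 - ip J x z)} \<sigma>) \<partial>coords J) \<partial>lborel)"
  proof (rule nn_integral_cong)
    fix \<sigma> :: real
    show "(\<integral>\<^sup>+Y. U Y \<sigma> \<partial>coords J) = (\<integral>\<^sup>+x. F x * (ennreal (\<sigma> powr (s + d)) * indicator {0<..<1 / (1 - ip J x z)} \<sigma>) \<partial>coords J)"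
    proof (cases "\<sigma> > 0")
      case True
      have "(\<integral>\<^sup>+Y. U Y \<sigma> \<partial>coords J) = (\<integral>\<^sup>+Y. ennreal (\<sigma> powr s) * (F (\<lambda>i\<in>J. Y i / \<sigma>) * indicator {0<..<1} (\<sigma> - \<sigma> * ip J (\<lambda>i\<in>J. Y i / \<sigma>) z)) \<partial>coords J)"
      proof (rule nn_integral_cong)
        fix Y :: "'a \<Rightarrow> real"
        have "ip J (\<lambda>i\<in>J. Y i / \<sigma>) z = ip J Y z / \<sigma>"
          using ip_scale[of J "1 / \<sigma>" Y z] by simp
        then show "U Y \<sigma> = ennreal (\<sigma> powr s) * (F (\<lambda>i\<in>J. Y i / \<sigma>) * indicator {0<..<1} (\<sigma> - \<sigma> * ip J (\<lambda>i\<in>J. Y i / \<sigma>) z))"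
          using True unfolding U_def by (simp add: mult_ac)
      qed
      also have "\<dots> = ennreal (\<sigma> powr s) * (\<integral>\<^sup>+Y. F (\<lambda>i\<in>J. Y i / \<sigma>) * indicator {0<..<1} (\<sigma> - \<sigma> * ip J (\<lambda>i\<in>J. Y i / \<sigma>) z) \<partial>coords J)"
        by (rule nn_integral_cmult) (simp only: ip_restrict, measurable)
      also have "(\<integral>\<^sup>+Y. F (\<lambda>i\<in>J. Y i / \<sigma>) * indicator {0<..<1} (\<sigma> - \<sigma> * ip J (\<lambda>i\<in>J. Y i / \<sigma>) z) \<partial>coords J)
        = ennreal (\<sigma> ^ d) * (\<integral>\<^sup>+x. F x * indicator {0<..<1} (\<sigma> - \<sigma> * ip J x z) \<partial>coords J)"
        by (rule scale[of "\<lambda>x. F x * indicator {0<..<1} (\<sigma> - \<sigma> * ip J x z)", OF _ True]) measurable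
      also have "ennreal (\<sigma> powr s) * \<dots> = ennreal (\<sigma> powr (s + d)) * (\<integral>\<^sup>+x. F x * indicator {0<..<1} (\<sigma> - \<sigma> * ip J x z) \<partial>coords J)"
        using True by (simp add: powr_add powr_realpow ennreal_mult mult.assoc)
      also have "\<dots> = (\<integral>\<^sup>+x. ennreal (\<sigma> powr (s + d)) * (F x * indicator {0<..<1} (\<sigma> - \<sigma> * ip J x z)) \<partial>coords J)"
        by (rule nn_integral_cmult[symmetric]) measurable
      also have "\<dots> = (\<integral>\<^sup>+x. F x * (ennreal (\<sigma> powr (s + d)) * indicator {0<..<1 / (1 - ip J x z)} \<sigma>) \<partial>coords J)"
      proof (rule nn_integral_cong)
        fix x assume x: "x \<in> space (coords J)"
        show "ennreal (\<sigma> powr (s + d)) * (F x * indicator {0<..<1} (\<sigma> - \<sigma> * ip J x z)) =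
          F x * (ennreal (\<sigma> powr (s + d)) * indicator {0<..<1 / (1 - ip J x z)} \<sigma>)"
        proof (cases "F x = 0")
          case False
          then have "0 < 1 - ip J x z" using lt[OF x] by simp
          moreover have "\<sigma> - \<sigma> * ip J x z = \<sigma> * (1 - ip J x z)" by (simp add: algebra_simps)
          ultimately have "\<sigma> - \<sigma> * ip J x z \<in> {0<..<1} \<longleftrightarrow> \<sigma> \<in> {0<..<1 / (1 - ip J x z)}"
            using True by (simp add: pos_less_divide_eq)
          then have "(indicator {0<..<1} (\<sigma> - \<sigma> * ip J x z) :: ennreal) = indicator {0<..<1 / (1 - ip J x z)} \<sigma>"
            unfolding indicator_def by simp
          then show ?thesis by (simp add: mult_ac)
        qed simp
      qed
      finally show ?thesis .
    qed (simp add: U_def)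
  qed
  also have "\<dots> = (\<integral>\<^sup>+x. (\<integral>\<^sup>+\<sigma>. F x * (ennreal (\<sigma> powr (s + d)) * indicator {0<..<1 / (1 - ip J x z)} \<sigma>) \<partial>lborel) \<partial>coords J)"
    by (rule pair.Fubini') (measurable, auto simp: indicator_def)
  also have "\<dots> = (\<integral>\<^sup>+x. F x * ennreal ((1 - ip J x z) powr - (s + d + 1)) * W \<partial>coords J)"
  proof (rule nn_integral_cong)
    fix x assume x: "x \<in> space (coords J)"
    show "(\<integral>\<^sup>+\<sigma>. F x * (ennreal (\<sigma> powr (s + d)) * indicator {0<..<1 / (1 - ip J x z)} \<sigma>) \<partial>lborel) =
      F x * ennreal ((1 - ip J x z) powr - (s + d + 1)) * W"
    proof (cases "F x = 0")
      case False
      then have p: "0 < 1 - ip J x z" using lt[OF x] by simp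
      then have p': "0 < 1 / (1 - ip J x z)" by simp
      have "(1 / (1 - ip J x z)) powr (s + d + 1) = (1 - ip J x z) powr - (s + d + 1)"
        unfolding powr_minus_divide using p by (subst powr_divide) auto
      then show ?thesis
        using truncated_power_scale[OF p', of "s + d"]
        by (subst nn_integral_cmult) (auto simp: W_def mult.assoc)
    qed simp
  qed
  also have "\<dots> = (\<integral>\<^sup>+x. F x * ennreal ((1 - ip J x z) powr - (s + d + 1)) \<partial>coords J) * W"
    by (rule nn_integral_multc) measurable
  finally have eq: "W * (\<integral>\<^sup>+y. g y \<partial>coords J) = W * (\<integral>\<^sup>+x. F x * ennreal ((1 - ip J x z) powr - (s + d + 1)) \<partial>coords J)"
    by (simp add: mult.commute)
  have "W \<noteq> 0" "W < \<infinity>" unfolding W_def by (rule truncated_power_nonzero, rule truncated_power_finite) (use s in auto)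
  then show ?thesis
    using arg_cong[OF eq, of "\<lambda>x. inverse W * x"] unfolding g_def d_def by (simp add: ennreal_inverse_mult_cancel)
qed

lemma one_minus_powr_ge:
  fixes u p :: real
  assumes "u < 1" "p > 0"
  shows "1 + p * u \<le> (1 - u) powr - p"
proof -
  have "ln (1 - u) \<le> - u" using ln_le_minus_one[of "1 - u"] assms by simp
  then have "p * u \<le> - p * ln (1 - u)" using mult_left_mono[of "ln (1 - u)" "- u" p] assms by simp
  then have "exp (p * u) \<le> exp (- p * ln (1 - u))" by simp
  also have "\<dots> = (1 - u) powr - p" using assms by (simp add: powr_def)
  finally show ?thesis using exp_ge_add_one_self[of "p * u"] by linarith
qed

text \<open>The barycentre minimises the integral of the polar: the density factor
$(1-\langle x,z\rangle)^{-p}$ lies above its tangent $1+p\langle x,z\rangle$ at \<open>0\<close>, and the linear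
term integrates to zero against \<open>F\<close>.\<close>

lemma projective_pull_integral_ge:
  assumes fin: "finite J" and s: "s > 0"
    and F [measurable]: "F \<in> borel_measurable (coords J)"
    and R: "\<And>x i. x \<in> space (coords J) \<Longrightarrow> F x \<noteq> 0 \<Longrightarrow> i \<in> J \<Longrightarrow> \<bar>x i\<bar> \<le> R"
    and Ffin: "(\<integral>\<^sup>+x. F x \<partial>coords J) < \<infinity>"
    and bary: "\<And>i. i \<in> J \<Longrightarrow> (LINT x|density (coords J) F. x i) = 0"
    and lt: "\<And>x. x \<in> space (coords J) \<Longrightarrow> F x \<noteq> 0 \<Longrightarrow> ip J x z < 1"
  shows "(\<integral>\<^sup>+x. F x \<partial>coords J) \<le> (\<integral>\<^sup>+y. projective_pull J s z F y \<partial>coords J)"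
proof -
  define N where "N = density (coords J) F"
  have [measurable_cong]: "sets N = sets (coords J)" unfolding N_def by simp
  define p where "p = s + card J + 1"
  have p: "p > 0" using s unfolding p_def by simp
  have N_space: "emeasure N (space N) = (\<integral>\<^sup>+x. F x \<partial>coords J)"
    unfolding N_def by (subst emeasure_density) (auto intro!: nn_integral_cong)
  interpret finite_measure N by (rule finite_measureI) (use N_space Ffin in auto)
  have N_coord: "integrable N (\<lambda>x. x i)" if "i \<in> J" for i
  proof (rule integrable_const_bound[where B = R])
    show "AE x in N. norm (x i) \<le> R"
      unfolding N_def by (rule density_AE_nonzero) (use that R in auto)
  qed (use that in measurable)
  have int: "integrable N (\<lambda>x. ip J x z)"
    unfolding ip_def by (intro Bochner_Integration.integrable_sum integrable_mult_left N_coord)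
  have "(LINT x|N. ip J x z) = 0"
    unfolding ip_def using bary N_coord by (subst Bochner_Integration.integral_sum) (auto simp: N_def)
  then have one: "(LINT x|N. 1 + p * ip J x z) = measure N (space N)"
    using int by (subst Bochner_Integration.integral_add) auto
  have "(\<integral>\<^sup>+x. F x \<partial>coords J) = ennreal (LINT x|N. 1 + p * ip J x z)"
    unfolding one N_space[symmetric] by (rule emeasure_eq_measure)
  also have "\<dots> \<le> ennreal (LINT x|N. max 0 (1 + p * ip J x z))"
    using int by (intro ennreal_leI integral_mono) auto
  also have "\<dots> = (\<integral>\<^sup>+x. ennreal (max 0 (1 + p * ip J x z)) \<partial>N)"
    using int by (intro nn_integral_eq_integral[symmetric]) auto
  also have "\<dots> \<le> (\<integral>\<^sup>+x. ennreal ((1 - ip J x z) powr - p) \<partial>N)"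
  proof (rule nn_integral_mono_AE)
    have "AE x in N. ip J x z < 1" unfolding N_def by (rule density_AE_nonzero) (use lt in auto)
    then show "AE x in N. ennreal (max 0 (1 + p * ip J x z)) \<le> ennreal ((1 - ip J x z) powr - p)"
      by eventually_elim (use one_minus_powr_ge[OF _ p] in \<open>auto intro!: ennreal_leI\<close>)
  qed
  also have "\<dots> = (\<integral>\<^sup>+x. F x * ennreal ((1 - ip J x z) powr - p) \<partial>coords J)"
    unfolding N_def by (rule nn_integral_density) measurable
  also have "\<dots> = (\<integral>\<^sup>+y. projective_pull J s z F y \<partial>coords J)"
    unfolding p_def by (rule projective_pull_integral[OF fin s F lt, symmetric])
  finally show ?thesis .
qed

section \<open>Induction on the dimension\<close>

text \<open>Hyperplanes are null, so the distribution of the \<open>k\<close>-th coordinate has no atoms and the intermediate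
value theorem gives a median.\<close>

lemma halving_hyperplane:
  fixes f :: "('i \<Rightarrow> real) \<Rightarrow> ennreal"
  assumes fin [simp]: "finite I" "k \<notin> I"
    and f [measurable]: "f \<in> borel_measurable (coords (insert k I))"
    and R: "\<And>x. x \<in> space (coords (insert k I)) \<Longrightarrow> f x \<noteq> 0 \<Longrightarrow> \<bar>x k\<bar> \<le> R"
    and M: "(\<integral>\<^sup>+x. f x \<partial>coords (insert k I)) = M" "M < \<infinity>"
  obtains c where "(\<integral>\<^sup>+x. f x * indicator {x. x k > c} x \<partial>coords (insert k I)) = ennreal (1 / 2) * M"
    and "(\<integral>\<^sup>+x. f x * indicator {x. x k < c} x \<partial>coords (insert k I)) = ennreal (1 / 2) * M"
proof -
  let ?J = "insert k I"
  define N where "N = distr (density (coords ?J) f) borel (\<lambda>x. x k)"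
  have [simp]: "sets N = sets borel" "space N = UNIV" unfolding N_def by auto
  have N_eq: "emeasure N A = (\<integral>\<^sup>+x. f x * indicator {x. x k \<in> A} x \<partial>coords ?J)" if [measurable]: "A \<in> sets borel" for A
  proof -
    have "emeasure N A = (\<integral>\<^sup>+x. f x * indicator ((\<lambda>x. x k) -` A \<inter> space (coords ?J)) x \<partial>coords ?J)"
      unfolding N_def by (subst emeasure_distr) (auto simp: emeasure_density)
    also have "\<dots> = (\<integral>\<^sup>+x. f x * indicator {x. x k \<in> A} x \<partial>coords ?J)"
      by (intro nn_integral_cong) (auto simp: indicator_def)
    finally show ?thesis .
  qed
  have N_UNIV: "emeasure N UNIV = M" using N_eq[of UNIV] M by simp
  interpret N: finite_borel_measure N
    by (intro finite_borel_measure.intro finite_measureI finite_borel_measure_axioms.intro) (use N_UNIV M(2) in auto)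
  have atom: "measure N {t} = 0" for t
  proof -
    have "emeasure N {t} = (\<integral>\<^sup>+x. f x * indicator {x. x k \<in> {t}} x \<partial>coords ?J)"
      by (rule N_eq) simp
    also have "\<dots> = (\<integral>\<^sup>+y. (\<integral>\<^sup>+r. f (y(k := r)) * indicator {t} r \<partial>lborel) \<partial>coords I)"
      by (subst coords.product_nn_integral_insert) (auto simp: indicator_def)
    also have "\<dots> = (\<integral>\<^sup>+y. 0 \<partial>coords I)"
    proof (rule nn_integral_cong)
      fix y :: "'i \<Rightarrow> real"
      have "(\<integral>\<^sup>+r. f (y(k := r)) * indicator {t} r \<partial>lborel) = (\<integral>\<^sup>+r. 0 \<partial>(lborel :: real measure))"
      proof (rule nn_integral_cong_AE)
        have "AE r in lborel. r \<noteq> t" by (rule AE_lborel_singleton)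
        then show "AE r in lborel. f (y(k := r)) * indicator {t} r = 0"
          by eventually_elim simp
      qed
      then show "(\<integral>\<^sup>+r. f (y(k := r)) * indicator {t} r \<partial>lborel) = 0" by simp
    qed
    finally show ?thesis by (simp add: measure_def)
  qed
  define m where "m = measure N UNIV"
  have Mm: "M = ennreal m" unfolding m_def N_UNIV[symmetric] by (rule N.emeasure_eq_measure)
  have m0: "m \<ge> 0" unfolding m_def by simp
  define r where "r = \<bar>R\<bar> + 1"
  have "emeasure N {..-r} = 0"
    unfolding N_eq[OF atMost_borel]
    by (subst nn_integral_0_iff_AE) (use R in \<open>force simp: indicator_def r_def\<close>)+
  then have left: "cdf N (-r) = 0" by (simp add: cdf_def measure_def)
  have "emeasure N {..r} = M"
    unfolding N_eq[OF atMost_borel] M(1)[symmetric]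
    by (intro nn_integral_cong) (use R in \<open>force simp: indicator_def r_def\<close>)
  then have right: "cdf N r = m" unfolding cdf_def measure_def Mm using m0 by simp
  have "continuous_on {-r..r} (cdf N)"
    by (intro continuous_at_imp_continuous_on ballI) (simp add: N.isCont_cdf atom)
  then obtain c where c: "cdf N c = m / 2"
    using IVT'[of "cdf N" "-r" "m / 2" r] left right m0 unfolding r_def by auto
  have lower: "measure N {..<c} = m / 2"
  proof -
    have "measure N {..c} = measure N {..<c} + measure N {c}"
      by (subst N.finite_measure_Union[symmetric]) (auto intro: arg_cong[of _ _ "measure N"])
    then show ?thesis using c atom[of c] by (simp add: cdf_def)
  qed
  have upper: "measure N {c<..} = m / 2"
  proof -
    have "measure N UNIV = measure N {..c} + measure N {c<..}"
      by (subst N.finite_measure_Union[symmetric]) (auto intro: arg_cong[of _ _ "measure N"])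
    then show ?thesis using c by (simp add: cdf_def m_def)
  qed
  have half: "ennreal (m / 2) = ennreal (1 / 2) * M"
    unfolding Mm using m0 by (subst ennreal_mult[symmetric]) auto
  show thesis
  proof (rule that[of c])
    show "(\<integral>\<^sup>+x. f x * indicator {x. x k > c} x \<partial>coords ?J) = ennreal (1 / 2) * M"
      using N_eq[of "{c<..}"] upper N.emeasure_eq_measure[of "{c<..}"] half by simp
    show "(\<integral>\<^sup>+x. f x * indicator {x. x k < c} x \<partial>coords ?J) = ennreal (1 / 2) * M"
      using N_eq[of "{..<c}"] lower N.emeasure_eq_measure[of "{..<c}"] half by simp
  qed
qed

text \<open>A bound that is linear in \<open>G\<close> and inherited by minorants need only be shown for integrable
minorants with bounded support.\<close>

lemma coords_truncation:
  fixes G :: "('i \<Rightarrow> real) \<Rightarrow> ennreal"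
  assumes fin: "finite J" and [measurable]: "G \<in> borel_measurable (coords J)"
    and bd: "\<And>H R. H \<in> borel_measurable (coords J) \<Longrightarrow> (\<And>x. H x \<le> G x) \<Longrightarrow>
       (\<And>x i. H x \<noteq> 0 \<Longrightarrow> i \<in> J \<Longrightarrow> \<bar>x i\<bar> \<le> R) \<Longrightarrow> (\<integral>\<^sup>+x. H x \<partial>coords J) < \<infinity> \<Longrightarrow>
       a * (\<integral>\<^sup>+x. H x \<partial>coords J) \<le> b"
  shows "a * (\<integral>\<^sup>+x. G x \<partial>coords J) \<le> b"
proof -
  define B where "B n = {x. \<forall>i\<in>J. \<bar>x i\<bar> \<le> real n}" for n and x :: "'i \<Rightarrow> real"
  have B_sets [measurable]: "B n \<inter> space (coords J) \<in> sets (coords J)" for n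
  proof -
    have "B n \<inter> space (coords J) = {x \<in> space (coords J). \<forall>i\<in>J. \<bar>x i\<bar> \<le> real n}" unfolding B_def by auto
    also have "\<dots> \<in> sets (coords J)" using fin by measurable
    finally show ?thesis .
  qed
  define H where "H n x = min (G x) (of_nat n) * indicator (B n) x" for n x
  have [measurable]: "H n \<in> borel_measurable (coords J)" for n
  proof -
    have "(\<lambda>x. min (G x) (of_nat n) * indicator (B n \<inter> space (coords J)) x) \<in> borel_measurable (coords J)"
      by measurable
    then show ?thesis unfolding H_def by (rule measurable_cong[THEN iffD1, rotated]) (auto simp: indicator_def)
  qed
  have inc: "incseq H"
    unfolding incseq_def le_fun_def H_def
    by (auto simp: B_def indicator_def min_def intro: order_trans)
  have sup: "(SUP n. H n x) = G x" if "x \<in> space (coords J)" for x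
  proof (rule antisym)
    show "(SUP n. H n x) \<le> G x" by (rule SUP_least) (auto simp: H_def indicator_def)
    obtain n0 :: nat where n0: "(\<Sum>i\<in>J. \<bar>x i\<bar>) \<le> real n0" using real_arch_simple by auto
    have xB: "x \<in> B n" if "n0 \<le> n" for n
      unfolding B_def using n0 that member_le_sum[of _ J "\<lambda>i. \<bar>x i\<bar>"] fin by fastforce
    have "min (G x) (of_nat n) \<le> (SUP n. H n x)" for n
    proof -
      have "min (G x) (of_nat n) \<le> H (max n n0) x"
        unfolding H_def using xB[of "max n n0"] by (auto simp: min_le_iff_disj)
      also have "\<dots> \<le> (SUP n. H n x)" by (rule SUP_upper) simp
      finally show ?thesis .
    qed
    then have "(SUP n::nat. min (G x) (of_nat n)) \<le> (SUP n. H n x)" by (rule SUP_least)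
    then show "G x \<le> (SUP n. H n x)" by (simp add: SUP_min_nat)
  qed
  have "(\<integral>\<^sup>+x. G x \<partial>coords J) = (\<integral>\<^sup>+x. (SUP n. H n x) \<partial>coords J)"
    by (intro nn_integral_cong) (simp add: sup)
  also have "\<dots> = (SUP n. \<integral>\<^sup>+x. H n x \<partial>coords J)"
    by (rule nn_integral_monotone_convergence_SUP[OF inc]) measurable
  finally have eq: "(\<integral>\<^sup>+x. G x \<partial>coords J) = (SUP n. \<integral>\<^sup>+x. H n x \<partial>coords J)" .
  have "a * (\<integral>\<^sup>+x. H n x \<partial>coords J) \<le> b" for n
  proof (rule bd)
    show "H n x \<le> G x" for x by (auto simp: H_def indicator_def)
    show "\<bar>x i\<bar> \<le> real n" if "H n x \<noteq> 0" "i \<in> J" for x i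
      using that by (auto simp: H_def B_def indicator_def split: if_splits)
    have "(\<integral>\<^sup>+x. H n x \<partial>coords J) \<le> (\<integral>\<^sup>+x. of_nat n * indicator (Pi\<^sub>E J (\<lambda>_. {-real n..real n})) x \<partial>coords J)"
    proof (intro nn_integral_mono)
      fix x assume "x \<in> space (coords J)"
      then show "H n x \<le> of_nat n * indicator (Pi\<^sub>E J (\<lambda>_. {-real n..real n})) x"
        by (auto simp: H_def B_def indicator_def space_PiM PiE_iff abs_le_iff)
    qed
    also have "\<dots> = of_nat n * emeasure (coords J) (Pi\<^sub>E J (\<lambda>_. {-real n..real n}))"
      using fin by (intro nn_integral_cmult_indicator sets_PiM_I_finite) auto
    also have "\<dots> = of_nat n * (\<Prod>i\<in>J. ennreal (2 * real n))"
      using fin by (subst coords.emeasure_PiM) auto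
    also have "\<dots> < \<infinity>"
      by (simp add: ennreal_mult_less_top of_nat_less_top power_less_top_ennreal)
    finally show "(\<integral>\<^sup>+x. H n x \<partial>coords J) < \<infinity>" .
  qed measurable
  then show ?thesis unfolding eq SUP_mult_left_ennreal by (rule SUP_least)
qed

text \<open>Here the roles of the two functions are exchanged: the hyperplane statement is applied to a
truncation of \<open>G\<close> and a halving coordinate hyperplane, where the constant is \<open>1\<close>. It produces a
centre \<open>z\<close> for \<open>G\<close>; moving the polarity from \<open>0\<close> to \<open>z\<close> turns \<open>F\<close> into its projective pull-back,
whose integral is at least that of \<open>F\<close> since \<open>F\<close> has barycentre \<open>0\<close>.\<close>

lemma centred_santalo_insert:
  fixes I :: "'i set"
  assumes fin [simp]: "finite I" "k \<notin> I" and s: "s > 0" and Q: "centred_santalo I (s + 1)"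
  shows "centred_santalo (insert k I) s"
  unfolding centred_santalo_def
proof (intro allI impI)
  fix F G :: "('i \<Rightarrow> real) \<Rightarrow> ennreal" and R
  let ?J = "insert k I"
  assume F [measurable]: "F \<in> borel_measurable (coords ?J)" and G [measurable]: "G \<in> borel_measurable (coords ?J)"
    and R: "\<forall>x\<in>space (coords ?J). F x \<noteq> 0 \<longrightarrow> (\<forall>i\<in>?J. \<bar>x i\<bar> \<le> R)"
    and Ffin: "(\<integral>\<^sup>+x. F x \<partial>coords ?J) < \<infinity>"
    and bary: "\<forall>i\<in>?J. (LINT x|density (coords ?J) F. x i) = 0"
    and le: "\<forall>x\<in>space (coords ?J). \<forall>y\<in>space (coords ?J). F x * G y \<le> pos_powr s (1 - ip ?J x y)"
  show "(\<integral>\<^sup>+x. F x \<partial>coords ?J) * (\<integral>\<^sup>+x. G x \<partial>coords ?J) \<le> (ball_const ?J s)\<^sup>2"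
  proof (rule coords_truncation)
    fix H :: "('i \<Rightarrow> real) \<Rightarrow> ennreal" and R'
    assume H [measurable]: "H \<in> borel_measurable (coords ?J)" and HG: "\<And>x. H x \<le> G x"
      and R': "\<And>x i. H x \<noteq> 0 \<Longrightarrow> i \<in> ?J \<Longrightarrow> \<bar>x i\<bar> \<le> R'" and Hfin: "(\<integral>\<^sup>+x. H x \<partial>coords ?J) < \<infinity>"
    define M where "M = (\<integral>\<^sup>+x. H x \<partial>coords ?J)"
    show "(\<integral>\<^sup>+x. F x \<partial>coords ?J) * (\<integral>\<^sup>+x. H x \<partial>coords ?J) \<le> (ball_const ?J s)\<^sup>2"
    proof (cases "M = 0")
      case False
      then have M: "0 < M" "M < \<infinity>" using Hfin by (auto simp: M_def zero_less_iff_neq_zero)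
      obtain c where c: "(\<integral>\<^sup>+x. H x * indicator {x. x k > c} x \<partial>coords ?J) = ennreal (1 / 2) * M"
          "(\<integral>\<^sup>+x. H x * indicator {x. x k < c} x \<partial>coords ?J) = ennreal (1 / 2) * M"
        by (rule halving_hyperplane[OF fin H, of R' M]) (use R' M M_def in auto)
      have c2: "(\<integral>\<^sup>+x. H x * indicator {x. x k < c} x \<partial>coords ?J) = ennreal (1 - 1 / 2) * M" using c(2) by simp
      have R'': "\<forall>x\<in>space (coords ?J). H x \<noteq> 0 \<longrightarrow> (\<forall>i\<in>?J. \<bar>x i\<bar> \<le> R')"
        using R' by blast
      have half: "0 < (1/2::real)" "(1/2::real) < 1" by auto
      obtain z where z_hull: "\<And>x. (\<And>w. w \<in> space (coords ?J) \<Longrightarrow> H w \<noteq> 0 \<Longrightarrow> ip ?J x w < 1) \<Longrightarrow> ip ?J x z < 1"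
        and z: "\<And>g. g \<in> borel_measurable (coords ?J) \<Longrightarrow>
          (\<And>x y. x \<in> space (coords ?J) \<Longrightarrow> y \<in> space (coords ?J) \<Longrightarrow>
             H (\<lambda>i\<in>?J. z i + x i) * g y \<le> pos_powr s (1 - ip ?J x y)) \<Longrightarrow>
          M * (\<integral>\<^sup>+y. g y \<partial>coords ?J) \<le> ennreal (1 / (4 * (1/2) * (1 - 1/2))) * (ball_const ?J s)\<^sup>2"
        by (rule hyperplane_santalo[where I = I and k = k and s = s and f = H and R = R' and M = M and lam = "1/2" and c = c,
              OF fin s Q H R'' M_def[symmetric] M half c(1) c2]) auto
      have lt: "ip ?J x z < 1" if x: "x \<in> space (coords ?J)" "F x \<noteq> 0" for x
      proof (rule z_hull)
        fix w assume w: "w \<in> space (coords ?J)" "H w \<noteq> 0"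
        have "G w \<noteq> 0" using HG[of w] w by auto
        then have "F x * G w \<noteq> 0" using x by simp
        then have "pos_powr s (1 - ip ?J x w) \<noteq> 0" using le x w by (metis le_zero_eq)
        then show "ip ?J x w < 1" using s by (auto simp: pos_powr_def max_def split: if_splits)
      qed
      define g where "g = projective_pull ?J s z F"
      have "M * (\<integral>\<^sup>+y. g y \<partial>coords ?J) \<le> ennreal (1 / (4 * (1/2) * (1 - 1/2))) * (ball_const ?J s)\<^sup>2"
      proof (rule z)
        show "g \<in> borel_measurable (coords ?J)" unfolding g_def by measurable
        fix x y assume x: "x \<in> space (coords ?J)" and y: "y \<in> space (coords ?J)"
        define a where "a = 1 + ip ?J y z"
        show "H (\<lambda>i\<in>?J. z i + x i) * g y \<le> pos_powr s (1 - ip ?J x y)"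
        proof (cases "0 < a")
          case True
          let ?y = "\<lambda>i\<in>?J. y i / a" and ?x = "\<lambda>i\<in>?J. z i + x i"
          have sp: "?y \<in> space (coords ?J)" "?x \<in> space (coords ?J)" by (auto simp: space_PiM)
          have "H ?x * g y = ennreal (a powr s) * (F ?y * H ?x)"
            using True unfolding g_def projective_pull_def a_def by (simp add: mult_ac)
          also have "\<dots> \<le> ennreal (a powr s) * (F ?y * G ?x)"
            by (intro mult_left_mono HG) auto
          also have "\<dots> \<le> ennreal (a powr s) * pos_powr s (1 - ip ?J ?y ?x)"
            by (intro mult_left_mono le[rule_format] sp) auto
          also have "\<dots> = pos_powr s (a * (1 - ip ?J ?y ?x))"
          proof -
            have "max (a * t) 0 = a * max t 0" for t using True by (auto simp: max_def zero_le_mult_iff mult_le_0_iff)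
            then show ?thesis using True unfolding pos_powr_def by (simp add: powr_mult ennreal_mult)
          qed
          also have "a * (1 - ip ?J ?y ?x) = 1 - ip ?J x y"
          proof -
            have "ip ?J ?y ?x = (1 / a) * (ip ?J y z + ip ?J y x)"
              unfolding ip_restrict using ip_scale[of ?J "1 / a" y "\<lambda>i. z i + x i"] ip_add[of ?J z x y]
              by (simp add: ip_commute)
            then have "a * (1 - ip ?J ?y ?x) = a - (ip ?J y z + ip ?J y x)" using True by (simp add: field_simps)
            then show ?thesis unfolding a_def by (simp add: ip_commute)
          qed
          finally show ?thesis .
        next
          case False
          then show ?thesis unfolding g_def projective_pull_def a_def by simp
        qed
      qed
      moreover have "(\<integral>\<^sup>+x. F x \<partial>coords ?J) \<le> (\<integral>\<^sup>+y. g y \<partial>coords ?J)"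
        unfolding g_def
        by (rule projective_pull_integral_ge[where R = R]) (use s R Ffin bary lt in auto)
      ultimately have "M * (\<integral>\<^sup>+x. F x \<partial>coords ?J) \<le> (ball_const ?J s)\<^sup>2"
        using mult_left_mono[of "\<integral>\<^sup>+x. F x \<partial>coords ?J" "\<integral>\<^sup>+y. g y \<partial>coords ?J" M] by (auto intro: order_trans)
      then show ?thesis unfolding M_def by (simp add: mult.commute)
    qed (simp add: M_def)
  qed (auto simp: fin)
qed

lemma centred_santalo_empty: "centred_santalo {} s"
  unfolding centred_santalo_def ball_const_empty
  by (simp add: coords.nn_integral_empty PiM_empty nn_integral_count_space_finite ip_def pos_powr_def)

theorem centred_santalo:
  assumes "finite I" "s > 0"
  shows "centred_santalo I s"
  using assms
proof (induction I arbitrary: s rule: finite_induct)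
  case (insert k I)
  then show ?case using insert.IH[of "s + 1"] by (intro centred_santalo_insert) auto
qed (rule centred_santalo_empty)

section \<open>Boundedness of the support\<close>

text \<open>A superlevel set of \<open>f\<close> contains a ball, since otherwise the support would be a countable union of
convex sets with empty interior and hence negligible. By concavity, \<open>f\<close> is bounded below along the
first half of the cone from this ball to any point of the support. A far away point would give many
disjoint balls of a fixed size on which \<open>f\<close> exceeds a fixed constant.\<close>

lemma bounded_support:
  fixes f :: "'a::euclidean_space \<Rightarrow> real"
  assumes s: "s > 0" and f0: "\<And>x. f x \<ge> 0" and conc: "inv_concave s f"
    and int: "integrable lebesgue f" and pos: "0 < (LINT x|lebesgue. f x)"
  shows "bounded {x. f x > 0}"
proof -
  define h where "h x = f x powr (1 / s)" for x
  define S where "S = {x. f x > 0}"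
  have concave: "concave_on S h" using conc unfolding inv_concave_def S_def h_def .
  then have "convex S" unfolding concave_on_def convex_on_def by auto
  have h_ge: "(1 - t) * h x + t * h y \<le> h ((1 - t) *\<^sub>R x + t *\<^sub>R y)"
    and h_mem: "(1 - t) *\<^sub>R x + t *\<^sub>R y \<in> S" if "x \<in> S" "y \<in> S" "0 \<le> t" "t \<le> 1" for x y t
  proof -
    show "(1 - t) *\<^sub>R x + t *\<^sub>R y \<in> S" using \<open>convex S\<close> that unfolding convex_def by simp
    show "(1 - t) * h x + t * h y \<le> h ((1 - t) *\<^sub>R x + t *\<^sub>R y)"
      using convex_onD[OF concave[unfolded concave_on_def], of t x y] that by simp
  qed
  define L where "L e = {x \<in> S. e \<le> h x}" for e
  have L_convex: "convex (L e)" for e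
    unfolding convex_alt
  proof (intro ballI allI impI)
    fix x y and t :: real assume *: "x \<in> L e" "y \<in> L e" "0 \<le> t \<and> t \<le> 1"
    have "e = (1 - t) * e + t * e" by (simp add: algebra_simps)
    also have "\<dots> \<le> (1 - t) * h x + t * h y"
      using * by (intro add_mono mult_left_mono) (auto simp: L_def)
    also have "\<dots> \<le> h ((1 - t) *\<^sub>R x + t *\<^sub>R y)" using * by (intro h_ge) (auto simp: L_def)
    finally show "(1 - t) *\<^sub>R x + t *\<^sub>R y \<in> L e"
      using h_mem[of x y t] * by (auto simp: L_def)
  qed
  have h_pos: "h x > 0" if "x \<in> S" for x using that unfolding h_def S_def by simp
  have S_eq: "S = (\<Union>n::nat. L (1 / Suc n))"
  proof
    show "S \<subseteq> (\<Union>n::nat. L (1 / Suc n))"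
    proof
      fix x assume x: "x \<in> S"
      then obtain n :: nat where "inverse (real (Suc n)) < h x" using reals_Archimedean[OF h_pos] by auto
      then show "x \<in> (\<Union>n::nat. L (1 / Suc n))" using x by (auto simp: L_def inverse_eq_divide intro!: exI[of _ n])
    qed
  qed (auto simp: L_def)
  have "\<exists>n::nat. interior (L (1 / Suc n)) \<noteq> {}"
  proof (rule ccontr)
    assume "\<not> ?thesis"
    then have "negligible (L (1 / Suc n))" for n :: nat
      using negligible_convex_interior[OF L_convex] by auto
    then have "negligible S" unfolding S_eq by (intro negligible_countable_Union[of "range _"]) auto
    then have "AE x in lebesgue. x \<notin> S"
      by (simp add: negligible_iff_null_sets AE_not_in)
    then have "AE x in lebesgue. f x = 0"
      by eventually_elim (use f0 in \<open>auto simp: S_def less_le\<close>)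
    then have "(LINT x|lebesgue. f x) = (LINT x|(lebesgue :: 'a measure). 0)"
      using int by (intro integral_cong_AE) auto
    then show False using pos by simp
  qed
  then obtain n :: nat and a where "a \<in> interior (L (1 / Suc n))" by auto
  then obtain r where r: "r > 0" "ball a r \<subseteq> L (1 / Suc n)" by (auto simp: mem_interior)
  define e where "e = 1 / real (Suc n)"
  have e: "e > 0" unfolding e_def by simp
  define \<eta> where "\<eta> = (e / 2) powr s"
  have \<eta>: "\<eta> > 0" unfolding \<eta>_def using e by simp
  define V where "V = {x. \<eta> \<le> f x}"
  have [measurable]: "f \<in> borel_measurable lebesgue" using int by (rule borel_measurable_integrable)
  have V_sets [measurable]: "V \<in> sets lebesgue"
  proof -
    have "{x \<in> space lebesgue. \<eta> \<le> f x} \<in> sets lebesgue" by measurable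
    then show ?thesis unfolding V_def by simp
  qed
  have V_fin: "emeasure lebesgue V < \<infinity>"
  proof -
    have "ennreal \<eta> * emeasure lebesgue V = (\<integral>\<^sup>+x. ennreal \<eta> * indicator V x \<partial>lebesgue)"
      by (rule nn_integral_cmult_indicator[symmetric]) simp
    also have "\<dots> \<le> (\<integral>\<^sup>+x. ennreal (f x) \<partial>lebesgue)"
      by (intro nn_integral_mono) (auto simp: V_def indicator_def intro!: ennreal_leI)
    also have "\<dots> < \<infinity>" using nn_integral_eq_integral[OF int] f0 by simp
    finally show ?thesis using \<eta> by (auto simp: ennreal_mult_less_top)
  qed
  define w where "w = unit_ball_vol (DIM('a)) * (r / 2) ^ DIM('a)"
  have w: "w > 0" unfolding w_def using r by simp
  obtain N :: nat where N: "measure lebesgue V / w < real N" using reals_Archimedean2 by auto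
  have "norm (x - a) \<le> 2 * r * real N" if x: "x \<in> S" for x
  proof (rule ccontr)
    assume "\<not> ?thesis"
    then have rho: "norm (x - a) > 2 * r * real N" by simp
    have rho0: "norm (x - a) > 0" using rho r by (smt (verit) mult_nonneg_nonneg of_nat_0_le_iff)
    define t where "t j = real j * r / norm (x - a)" for j :: nat
    define p where "p j = a + t j *\<^sub>R (x - a)" for j
    have t: "0 \<le> t j" "t j \<le> 1 / 2" if "j < N" for j
    proof -
      show "0 \<le> t j" unfolding t_def using r by simp
      have "real j * r \<le> real N * r" using that r by (intro mult_right_mono) auto
      then show "t j \<le> 1 / 2" unfolding t_def using rho rho0 by (simp add: field_simps)
    qed
    have sub: "ball (p j) (r / 2) \<subseteq> V" if j: "j < N" for j
    proof
      fix y assume y: "y \<in> ball (p j) (r / 2)"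
      \<comment> \<open>\<open>y\<close> divides the segment from a point \<open>b\<close> of the big ball to \<open>x\<close> in the ratio of \<open>p j\<close>.\<close>
      define b where "b = a + (1 / (1 - t j)) *\<^sub>R (y - p j)"
      have t1: "1 - t j \<ge> 1 / 2" using t[OF j] by simp
      have "norm (b - a) = norm (y - p j) / (1 - t j)" unfolding b_def using t1 by simp
      also have "\<dots> \<le> norm (y - p j) / (1 / 2)" using t1 by (intro divide_left_mono) auto
      also have "\<dots> < r" using y by (simp add: dist_norm norm_minus_commute)
      finally have "b \<in> L e" using r unfolding e_def by (auto simp: dist_norm norm_minus_commute)
      then have bS: "b \<in> S" "h b \<ge> e" unfolding L_def by auto
      have yb: "y = (1 - t j) *\<^sub>R b + t j *\<^sub>R x"
      proof -
        have "(1 - t j) *\<^sub>R b = (1 - t j) *\<^sub>R a + (y - p j)"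
          unfolding b_def using t1 by (simp add: scaleR_right_distrib)
        then show ?thesis unfolding p_def by (simp add: algebra_simps)
      qed
      have "e / 2 \<le> (1 - t j) * h b" using mult_mono[of "1/2" "1 - t j" e "h b"] t1 bS e by simp
      also have "\<dots> \<le> (1 - t j) * h b + t j * h x" using t[OF j] h_pos[OF x] by simp
      also have "\<dots> \<le> h y" unfolding yb using t[OF j] bS x by (intro h_ge) auto
      finally have "(e / 2) powr s \<le> h y powr s" using e s by (intro powr_mono2) auto
      also have "h y powr s = f y" unfolding h_def using s f0[of y] by (simp add: powr_powr)
      finally show "y \<in> V" unfolding V_def \<eta>_def by simp
    qed
    have disj: "disjoint_family_on (\<lambda>j. ball (p j) (r / 2)) {..<N}"
      unfolding disjoint_family_on_def
    proof (intro ballI impI)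
      fix i j :: nat assume ij: "i \<noteq> j"
      have "dist (p i) (p j) = \<bar>t i - t j\<bar> * norm (x - a)"
        unfolding p_def dist_norm by (simp add: scaleR_left_diff_distrib[symmetric])
      also have "\<dots> = \<bar>real i - real j\<bar> * r"
        unfolding t_def using rho0 r by (simp add: diff_divide_distrib[symmetric] left_diff_distrib[symmetric] abs_mult)
      also have "\<dots> \<ge> 1 * r" using ij r by (intro mult_right_mono) auto
      finally show "ball (p i) (r / 2) \<inter> ball (p j) (r / 2) = {}" by (intro disjoint_ballI) simp
    qed
    have "ennreal (real N * w) = (\<Sum>j<N. emeasure lebesgue (ball (p j) (r / 2)))"
      using r w by (simp add: emeasure_ball w_def ennreal_mult ennreal_of_nat_eq_real_of_nat)
    also have "\<dots> = emeasure lebesgue (\<Union>j<N. ball (p j) (r / 2))"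
      by (rule sum_emeasure) (use disj in auto)
    also have "\<dots> \<le> emeasure lebesgue V" by (rule emeasure_mono) (use sub in auto)
    also have "\<dots> = ennreal (measure lebesgue V)" using V_fin by (intro emeasure_eq_ennreal_measure) auto
    finally have "real N * w \<le> measure lebesgue V" by simp
    then show False using N w by (simp add: field_simps)
  qed
  then show ?thesis
    unfolding S_def bounded_def by (metis dist_norm dist_commute mem_Collect_eq norm_minus_commute)
qed

section \<open>Euclidean space\<close>

text \<open>An infimum of continuous functions is upper semicontinuous.\<close>

lemma s_polar_measurable [measurable]: "s > 0 \<Longrightarrow> s_polar s f \<in> borel_measurable borel"
proof (rule borel_measurableI_less)
  assume s: "s > 0"
  fix y
  let ?K = "\<lambda>x v. ennreal (max (1 - x \<bullet> v) 0 powr s / f x)"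
  have "{v \<in> space borel. s_polar s f v < y} = (\<Union>x\<in>{x. f x > 0}. {v. ?K x v < y})"
    unfolding s_polar_def by (auto simp: INF_less_iff)
  also have "open \<dots>"
  proof (intro open_UN ballI)
    fix x :: 'a assume x: "x \<in> {x. f x > 0}"
    have "continuous_on UNIV (?K x)"
      using s x by (intro continuous_on_ennreal continuous_on_divide continuous_on_powr' continuous_on_max continuous_intros) auto
    then show "open {v. ?K x v < y}" by (intro open_Collect_less continuous_intros)
  qed
  finally show "{v \<in> space borel. s_polar s f v < y} \<in> sets borel" by simp
qed

lemma mult_s_polar_le:
  assumes "f x \<ge> 0"
  shows "ennreal (f x) * s_polar s f y \<le> pos_powr s (1 - x \<bullet> y)"
proof (cases "f x > 0")
  case True
  then have "ennreal (f x) * s_polar s f y \<le> ennreal (f x) * ennreal (max (1 - x \<bullet> y) 0 powr s / f x)"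
    unfolding s_polar_def by (intro mult_left_mono INF_lower) auto
  also have "\<dots> = pos_powr s (1 - x \<bullet> y)"
    unfolding pos_powr_def using True by (simp add: ennreal_mult[symmetric])
  finally show ?thesis .
qed (use assms in auto)

text \<open>The product formulas above need Borel functions. Setting a Borel version to \<open>0\<close> on a null set that
contains all the disagreements gives a minorant, and passing to a minorant preserves the
pointwise polarity inequality everywhere.\<close>

lemma borel_minorant:
  fixes f :: "'a::euclidean_space \<Rightarrow> real"
  assumes "f \<in> borel_measurable lebesgue" "\<And>x. f x \<ge> 0"
  obtains f' where "f' \<in> borel_measurable borel" "\<And>x. f' x = 0 \<or> f' x = ennreal (f x)" "AE x in lebesgue. f' x = ennreal (f x)"
proof -
  have "(\<lambda>x. ennreal (f x)) \<in> borel_measurable (completion lborel)" using assms by measurable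
  from completion_ex_borel_measurable[OF this] obtain g where g: "g \<in> borel_measurable lborel" "AE x in lborel. ennreal (f x) = g x"
    by auto
  have "\<exists>N\<in>null_sets lborel. {x. ennreal (f x) \<noteq> g x} \<subseteq> N"
    using g(2) by (auto simp: eventually_ae_filter)
  then obtain N where N: "N \<in> null_sets lborel" "{x. ennreal (f x) \<noteq> g x} \<subseteq> N" by auto
  have gN: "g x = ennreal (f x)" if "x \<notin> N" for x using N(2) that by (metis (mono_tags, lifting) mem_Collect_eq subsetD)
  have [measurable]: "g \<in> borel_measurable borel" "N \<in> sets borel" using g(1) N(1) by (auto dest: null_setsD2)
  show thesis
  proof (rule that[of "\<lambda>x. if x \<in> N then 0 else g x"])
    show "(\<lambda>x. if x \<in> N then 0 else g x) \<in> borel_measurable borel" by measurable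
    show "(if x \<in> N then 0 else g x) = 0 \<or> (if x \<in> N then 0 else g x) = ennreal (f x)" for x using gN by auto
    have "AE x in lborel. x \<notin> N" using N(1) by (rule AE_not_in)
    then have "AE x in lborel. (if x \<in> N then 0 else g x) = ennreal (f x)"
      by eventually_elim (use gN in auto)
    then show "AE x in lebesgue. (if x \<in> N then 0 else g x) = ennreal (f x)" by (rule AE_completion)
  qed
qed

lemma ball_const_Basis:
  fixes kappa :: real
  assumes s: "s > 0" and "kappa = (LINT x:cball (0::'a::euclidean_space) 1|lebesgue. (1 - (norm x)\<^sup>2) powr (s / 2))"
  shows "ball_const (Basis :: 'a set) s = ennreal kappa"
proof -
  have sq: "ip Basis X X = (norm (\<Sum>b\<in>Basis. X b *\<^sub>R b :: 'a))\<^sup>2" for X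
    unfolding power2_norm_eq_inner ip_def
    by (subst euclidean_inner) (intro sum.cong, auto)
  have "ball_const (Basis :: 'a set) s = (\<integral>\<^sup>+x. pos_powr (s / 2) (1 - (norm x)\<^sup>2) \<partial>(lborel :: 'a measure))"
    unfolding ball_const_def sq by (rule nn_integral_lborel_coords[symmetric]) measurable
  also have "\<dots> = (\<integral>\<^sup>+x. ennreal (indicator (cball 0 1) x *\<^sub>R (1 - (norm x)\<^sup>2) powr (s / 2)) \<partial>(lebesgue :: 'a measure))"
  proof (subst nn_integral_completion, rule nn_integral_cong)
    fix x :: 'a
    show "pos_powr (s / 2) (1 - (norm x)\<^sup>2) = ennreal (indicator (cball 0 1) x *\<^sub>R (1 - (norm x)\<^sup>2) powr (s / 2))"
    proof (cases "norm x \<le> 1")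
      case True
      then have "(norm x)\<^sup>2 \<le> 1" by (simp add: power_le_one)
      then show ?thesis using True by (simp add: pos_powr_def)
    next
      case False
      then have "1 < (norm x)\<^sup>2" by (simp add: one_less_power)
      then show ?thesis using False s by (simp add: pos_powr_def)
    qed
  qed
  finally have eq: "ball_const (Basis :: 'a set) s = (\<integral>\<^sup>+x. ennreal (indicator (cball 0 1) x *\<^sub>R (1 - (norm x)\<^sup>2) powr (s / 2)) \<partial>(lebesgue :: 'a measure))" .
  have "kappa = enn2real (ball_const (Basis :: 'a set) s)"
    unfolding assms(2) eq set_lebesgue_integral_def
  proof (rule integral_eq_nn_integral)
    have "(\<lambda>x::'a. indicator (cball 0 1) x *\<^sub>R (1 - (norm x)\<^sup>2) powr (s / 2)) \<in> borel_measurable lborel"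
      unfolding measurable_lborel1
      by (intro borel_measurable_scaleR borel_measurable_indicator powr_real_measurable borel_measurable_diff borel_measurable_power) auto
    then show "(\<lambda>x::'a. indicator (cball 0 1) x *\<^sub>R (1 - (norm x)\<^sup>2) powr (s / 2)) \<in> borel_measurable lebesgue"
      by (rule measurable_completion)
  qed auto
  then show ?thesis using ball_const_finite[of "Basis :: 'a set" s] s by simp
qed

lemma AE_hyperplane:
  fixes u :: "'a::euclidean_space"
  assumes "u \<noteq> 0"
  shows "AE x in lborel. u \<bullet> x \<noteq> c"
proof -
  have "{x. u \<bullet> x = c} \<in> null_sets lebesgue"
    using negligible_hyperplane[of u c] assms by (simp add: negligible_iff_null_sets)
  then have "{x. u \<bullet> x = c} \<in> null_sets lborel"
    by (simp add: null_sets_completion_iff)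
  from AE_not_in[OF this] show ?thesis by simp
qed

lemma inner_sum_Basis_eq_ip:
  "(\<Sum>b\<in>Basis. X b *\<^sub>R b) \<bullet> (\<Sum>b\<in>Basis. Y b *\<^sub>R b :: 'a::euclidean_space) = ip Basis X Y"
  unfolding ip_def by (subst euclidean_inner) (intro sum.cong, auto)

theorem theorem4:
  fixes s lam kappa c :: real
    and f :: "'a::euclidean_space \<Rightarrow> real"
    and u :: 'a
    and H H_plus :: "'a set"
  assumes "s > 0"
    and "\<And>x. f x \<ge> 0"
    and "inv_concave s f"
    and "integrable lebesgue f"
    and "u \<noteq> 0"
    and "H = {x. u \<bullet> x = c}"
    and "H_plus = {x. u \<bullet> x \<ge> c}"
    and "0 < lam" and "lam < 1"
    and "lam * (LINT x|lebesgue. f x) = (LINT x:H_plus|lebesgue. f x)"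
    and "kappa = (LINT x:cball (0::'a) 1|lebesgue. (1 - (norm x)\<^sup>2) powr (s / 2))"
  shows "\<exists>z\<in>H. ennreal (LINT x|lebesgue. f x) *
      (\<integral>\<^sup>+ y. s_polar s (\<lambda>x. f (x + z)) y \<partial>lebesgue)
      \<le> ennreal (kappa\<^sup>2 / (4 * lam * (1 - lam)))"
proof -
  note s = assms(1) and f0 = assms(2) and int = assms(4) and u = assms(5) and lam = assms(8,9)
  define M where "M = (LINT x|lebesgue. f x)"
  have "M \<ge> 0" unfolding M_def using f0 by simp
  show ?thesis
  proof (cases "M = 0")
    case True
    have "(c / (u \<bullet> u)) *\<^sub>R u \<in> H" unfolding assms(6) using u by simp
    then show ?thesis using True unfolding M_def by (intro bexI) auto
  next
    case False
    with \<open>M \<ge> 0\<close> have M: "M > 0" by simp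
    obtain B where B: "\<And>x. f x > 0 \<Longrightarrow> norm x \<le> B"
      using bounded_support[OF s f0 assms(3) int] M unfolding M_def bounded_iff by auto
    have f_meas [measurable]: "f \<in> borel_measurable lebesgue" using int by (rule borel_measurable_integrable)
    obtain f' where f'_meas [measurable]: "f' \<in> borel_measurable borel"
      and f': "\<And>x. f' x = 0 \<or> f' x = ennreal (f x)" and f'_AE: "AE x in lebesgue. f' x = ennreal (f x)"
      using borel_minorant[OF f_meas f0] by blast
    have f'_int: "(\<integral>\<^sup>+x. f' x * indicator A x \<partial>lborel) = (\<integral>\<^sup>+x. ennreal (f x) * indicator A x \<partial>lebesgue)"
      if A [measurable]: "A \<in> sets borel" for A
    proof -
      have "(\<integral>\<^sup>+x. f' x * indicator A x \<partial>lborel) = (\<integral>\<^sup>+x. f' x * indicator A x \<partial>lebesgue)"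
        by (rule nn_integral_completion[symmetric])
      also have "\<dots> = (\<integral>\<^sup>+x. ennreal (f x) * indicator A x \<partial>lebesgue)"
        by (rule nn_integral_cong_AE) (use f'_AE in eventually_elim, simp)
      finally show ?thesis .
    qed
    have total: "(\<integral>\<^sup>+x. f' x \<partial>lborel) = ennreal M"
      using f'_int[of UNIV] nn_integral_eq_integral[OF int] f0 by (simp add: M_def)
    have "(\<integral>\<^sup>+x. f' x * indicator {x. u \<bullet> x > c} x \<partial>lborel) = (\<integral>\<^sup>+x. f' x * indicator H_plus x \<partial>lborel)"
      by (rule nn_integral_cong_AE) (use AE_hyperplane[OF u, of c] in eventually_elim, auto simp: assms(7) indicator_def)
    also have "\<dots> = (\<integral>\<^sup>+x. ennreal (indicator H_plus x *\<^sub>R f x) \<partial>lebesgue)"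
    proof (subst f'_int)
      show "H_plus \<in> sets borel" unfolding assms(7) by measurable
    qed (auto intro!: nn_integral_cong simp: indicator_def)
    also have "\<dots> = ennreal (lam * M)"
      unfolding M_def assms(10) set_lebesgue_integral_def
    proof (rule nn_integral_eq_integral)
      have "H_plus \<in> sets lebesgue" unfolding assms(7) by simp
      then show "integrable lebesgue (\<lambda>x. indicator H_plus x *\<^sub>R f x)"
        using int by (rule integrable_mult_indicator)
    qed (use f0 in auto)
    finally have upper: "(\<integral>\<^sup>+x. f' x * indicator {x. u \<bullet> x > c} x \<partial>lborel) = ennreal lam * ennreal M"
      using lam M by (simp add: ennreal_mult)
    have lower: "(\<integral>\<^sup>+x. f' x * indicator {x. u \<bullet> x < c} x \<partial>lborel) = ennreal (1 - lam) * ennreal M"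
    proof -
      have "ennreal M = (\<integral>\<^sup>+x. f' x * indicator {x. u \<bullet> x > c} x + f' x * indicator {x. u \<bullet> x < c} x \<partial>lborel)"
        unfolding total[symmetric]
        by (rule nn_integral_cong_AE) (use AE_hyperplane[OF u, of c] in eventually_elim, auto simp: indicator_def)
      also have "\<dots> = ennreal lam * ennreal M + (\<integral>\<^sup>+x. f' x * indicator {x. u \<bullet> x < c} x \<partial>lborel)"
        unfolding upper[symmetric] by (rule nn_integral_add) measurable
      finally have *: "ennreal M = ennreal lam * ennreal M + (\<integral>\<^sup>+x. f' x * indicator {x. u \<bullet> x < c} x \<partial>lborel)" .
      have **: "ennreal M = ennreal lam * ennreal M + ennreal (1 - lam) * ennreal M"
        using lam by (simp add: distrib_right[symmetric] ennreal_plus[symmetric] del: ennreal_plus)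
      show ?thesis
        using trans[OF *[symmetric] **] by (subst (asm) ennreal_add_left_cancel) (auto simp: ennreal_mult_eq_top_iff)
    qed

    obtain k where k: "k \<in> Basis" "u \<bullet> k \<noteq> 0" using u euclidean_all_zero_iff[of u] by auto
    \<comment> \<open>A basis vector \<open>k\<close> that is not parallel to the hyperplane gives the charts \<open>E\<close> and \<open>D\<close>, dual
      to each other, in which the hyperplane is \<open>X k = c / (u \<bullet> k)\<close>.\<close>
    define I where "I = (Basis :: 'a set) - {k}"
    have I: "finite I" "k \<notin> I" and BI: "Basis = insert k I" unfolding I_def using k by auto
    define q where "q b = (u \<bullet> b) / (u \<bullet> k)" for b
    define E where "E X = (\<Sum>b\<in>Basis. (X(k := X k - ip I X q)) b *\<^sub>R b :: 'a)" for X
    define D where "D Y = (\<Sum>b\<in>Basis. ((\<lambda>i\<in>I. Y i + Y k * q i)(k := Y k)) b *\<^sub>R b :: 'a)" for Y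
    have IB: "I \<subseteq> Basis" unfolding I_def by auto
    have kcoord: "(\<lambda>X. X k - ip I X q) \<in> borel_measurable (coords Basis)"
    proof (intro borel_measurable_diff measurable_ip_const IB)
      show "(\<lambda>X. X k) \<in> borel_measurable (coords Basis)" using k by measurable
    qed
    have E_meas [measurable]: "E \<in> borel_measurable (coords Basis)"
      unfolding E_def[abs_def]
    proof (intro borel_measurable_sum borel_measurable_scaleR)
      fix b :: 'a assume "b \<in> Basis"
      then show "(\<lambda>X. (X(k := X k - ip I X q)) b) \<in> borel_measurable (coords Basis)"
        using kcoord by (cases "b = k") auto
    qed auto
    have D_meas [measurable]: "D \<in> borel_measurable (coords Basis)"
      unfolding D_def[abs_def]
    proof (intro borel_measurable_sum borel_measurable_scaleR)
      fix b :: 'a assume "b \<in> Basis"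
      then show "(\<lambda>Y. ((\<lambda>i\<in>I. Y i + Y k * q i)(k := Y k)) b) \<in> borel_measurable (coords Basis)"
        using k BI by (cases "b = k") auto
    qed auto
    have E_int: "(\<integral>\<^sup>+x. h x \<partial>lborel) = (\<integral>\<^sup>+X. h (E X) \<partial>coords Basis)" if [measurable]: "h \<in> borel_measurable borel" for h
      unfolding E_def nn_integral_lborel_coords[OF that] BI
      by (rule coords_shear[OF I, of "\<lambda>X. h (\<Sum>b\<in>insert k I. X b *\<^sub>R b)", symmetric]) measurable
    have D_int: "(\<integral>\<^sup>+x. h x \<partial>lborel) = (\<integral>\<^sup>+X. h (D X) \<partial>coords Basis)" if [measurable]: "h \<in> borel_measurable borel" for h
      unfolding D_def nn_integral_lborel_coords[OF that] BI
      by (rule coords_dual_shear[OF I, of "\<lambda>X. h (\<Sum>b\<in>insert k I. X b *\<^sub>R b)", symmetric]) measurable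
    have uE: "u \<bullet> E X = (u \<bullet> k) * X k" for X
    proof -
      have "u \<bullet> E X = ip (insert k I) (X(k := X k - ip I X q)) ((\<lambda>b. u \<bullet> b)(k := u \<bullet> k))"
        unfolding E_def ip_def BI[symmetric] by (simp add: inner_sum_right mult.commute)
      also have "\<dots> = ip I X (\<lambda>b. u \<bullet> b) + (X k - ip I X q) * (u \<bullet> k)" by (rule ip_insert[OF I])
      also have "ip I X (\<lambda>b. u \<bullet> b) = ip I X q * (u \<bullet> k)"
        unfolding ip_def q_def sum_distrib_right using k by (intro sum.cong) auto
      finally show ?thesis by (simp add: algebra_simps)
    qed
    have ED: "E X \<bullet> D Y = ip Basis X Y" for X Y
    proof -
      have "E X \<bullet> D Y = ip I X (\<lambda>i\<in>I. Y i + Y k * q i) + (X k - ip I X q) * Y k"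
        unfolding E_def D_def inner_sum_Basis_eq_ip unfolding BI by (rule ip_insert[OF I])
      also have "ip I X (\<lambda>i\<in>I. Y i + Y k * q i) = ip I X Y + Y k * ip I X q"
        unfolding ip_restrict using ip_add[of I Y "\<lambda>i. Y k * q i" X] ip_scale[of I "Y k" q X] by (simp add: ip_commute)
      finally have "E X \<bullet> D Y = ip I X Y + X k * Y k" by (simp add: algebra_simps)
      also have "\<dots> = ip Basis X Y" unfolding BI using ip_insert[OF I, of X "X k" Y "Y k"] by simp
      finally show ?thesis .
    qed
    have E_add: "E (\<lambda>i\<in>Basis. Z i + X i) = E X + E Z" for X Z
    proof -
      have "ip I (\<lambda>i\<in>Basis. Z i + X i) q = ip I Z q + ip I X q"
        unfolding ip_add[symmetric] using IB by (intro ip_cong) auto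
      then show ?thesis unfolding E_def sum.distrib[symmetric] scaleR_left_distrib[symmetric]
        using k by (intro sum.cong) auto
    qed
    have E_coord: "\<bar>X b\<bar> \<le> (1 + norm u / \<bar>u \<bullet> k\<bar>) * norm (E X)" if b: "b \<in> Basis" for X b
    proof (cases "b = k")
      case True
      have "\<bar>u \<bullet> k\<bar> * \<bar>X k\<bar> \<le> norm u * norm (E X)"
        using Cauchy_Schwarz_ineq2[of u "E X"] unfolding uE abs_mult .
      then have "\<bar>X k\<bar> \<le> norm u / \<bar>u \<bullet> k\<bar> * norm (E X)" using k by (simp add: field_simps)
      also have "\<dots> \<le> (1 + norm u / \<bar>u \<bullet> k\<bar>) * norm (E X)" by (intro mult_right_mono) auto
      finally show ?thesis unfolding True .
    next
      case False
      have "E X \<bullet> b = X b" unfolding E_def using b False by simp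
      then have "\<bar>X b\<bar> \<le> norm (E X)" using Basis_le_norm[OF b, of "E X"] by simp
      also have "\<dots> \<le> (1 + norm u / \<bar>u \<bullet> k\<bar>) * norm (E X)"
        using mult_right_mono[of 1 "1 + norm u / \<bar>u \<bullet> k\<bar>" "norm (E X)"] by simp
      finally show ?thesis .
    qed

    define F where "F X = f' (E X)" for X
    have F_meas [measurable]: "F \<in> borel_measurable (coords (insert k I))"
      using measurable_compose[OF E_meas f'_meas] unfolding F_def[abs_def] BI .
    have F_supp: "\<forall>X\<in>space (coords (insert k I)). F X \<noteq> 0 \<longrightarrow> (\<forall>i\<in>insert k I. \<bar>X i\<bar> \<le> (1 + norm u / \<bar>u \<bullet> k\<bar>) * B)"
    proof (intro ballI impI)
      fix X i assume "F X \<noteq> 0" and i: "i \<in> insert k I"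
      then have "f (E X) > 0" using f'[of "E X"] f0[of "E X"] unfolding F_def by (cases "f (E X) = 0") auto
      from B[OF this] have "(1 + norm u / \<bar>u \<bullet> k\<bar>) * norm (E X) \<le> (1 + norm u / \<bar>u \<bullet> k\<bar>) * B" by (intro mult_left_mono) auto
      then show "\<bar>X i\<bar> \<le> (1 + norm u / \<bar>u \<bullet> k\<bar>) * B" using E_coord[of i X] i unfolding BI[symmetric] by linarith
    qed
    have F_total: "(\<integral>\<^sup>+X. F X \<partial>coords (insert k I)) = ennreal M"
      using E_int[OF f'_meas] total unfolding F_def BI by simp
    \<comment> \<open>For \<open>u \<bullet> k < 0\<close> the chart exchanges the two sides; the bound is symmetric in \<open>lam\<close> and \<open>1 - lam\<close>.\<close>
    define \<mu> where "\<mu> = (if u \<bullet> k > 0 then lam else 1 - lam)"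
    have mu: "0 < \<mu>" "\<mu> < 1" "4 * \<mu> * (1 - \<mu>) = 4 * lam * (1 - lam)" unfolding \<mu>_def using lam by auto
    have side: "(\<integral>\<^sup>+X. F X * indicator {X. X k > c / (u \<bullet> k)} X \<partial>coords (insert k I)) = ennreal \<mu> * ennreal M"
      "(\<integral>\<^sup>+X. F X * indicator {X. X k < c / (u \<bullet> k)} X \<partial>coords (insert k I)) = ennreal (1 - \<mu>) * ennreal M"
    proof -
      have up: "(\<integral>\<^sup>+X. F X * indicator {X. (u \<bullet> k) * X k > c} X \<partial>coords (insert k I)) = ennreal lam * ennreal M"
        using E_int[of "\<lambda>x. f' x * indicator {x. u \<bullet> x > c} x"] upper unfolding F_def BI by (simp add: indicator_def uE)
      have lo: "(\<integral>\<^sup>+X. F X * indicator {X. (u \<bullet> k) * X k < c} X \<partial>coords (insert k I)) = ennreal (1 - lam) * ennreal M"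
        using E_int[of "\<lambda>x. f' x * indicator {x. u \<bullet> x < c} x"] lower unfolding F_def BI by (simp add: indicator_def uE)
      show "(\<integral>\<^sup>+X. F X * indicator {X. X k > c / (u \<bullet> k)} X \<partial>coords (insert k I)) = ennreal \<mu> * ennreal M"
      proof (cases "u \<bullet> k > 0")
        case True
        then have "{X. X k > c / (u \<bullet> k)} = {X. (u \<bullet> k) * X k > c}" by (auto simp: pos_divide_less_eq mult.commute)
        then show ?thesis using True up by (simp add: \<mu>_def)
      next
        case False
        then have "{X. X k > c / (u \<bullet> k)} = {X. (u \<bullet> k) * X k < c}" using k by (auto simp: neg_divide_less_eq mult.commute)
        then show ?thesis using False lo by (simp add: \<mu>_def)
      qed
      show "(\<integral>\<^sup>+X. F X * indicator {X. X k < c / (u \<bullet> k)} X \<partial>coords (insert k I)) = ennreal (1 - \<mu>) * ennreal M"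
      proof (cases "u \<bullet> k > 0")
        case True
        then have "{X. X k < c / (u \<bullet> k)} = {X. (u \<bullet> k) * X k < c}" by (auto simp: pos_less_divide_eq mult.commute)
        then show ?thesis using True lo by (simp add: \<mu>_def)
      next
        case False
        then have "{X. X k < c / (u \<bullet> k)} = {X. (u \<bullet> k) * X k > c}" using k by (auto simp: neg_less_divide_eq mult.commute)
        then show ?thesis using False up by (simp add: \<mu>_def)
      qed
    qed
    have Q: "centred_santalo I (s + 1)" using I s by (intro centred_santalo) auto
    have M': "0 < ennreal M" "ennreal M < \<infinity>" using M by auto
    obtain Z where Zk: "Z k = c / (u \<bullet> k)"
      and Z: "\<And>g. g \<in> borel_measurable (coords (insert k I)) \<Longrightarrow>
          (\<And>x y. x \<in> space (coords (insert k I)) \<Longrightarrow> y \<in> space (coords (insert k I)) \<Longrightarrow>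
             F (\<lambda>i\<in>insert k I. Z i + x i) * g y \<le> pos_powr s (1 - ip (insert k I) x y)) \<Longrightarrow>
          ennreal M * (\<integral>\<^sup>+y. g y \<partial>coords (insert k I)) \<le> ennreal (1 / (4 * \<mu> * (1 - \<mu>))) * (ball_const (insert k I) s)\<^sup>2"
      by (rule hyperplane_santalo[where I = I and k = k and s = s and f = F and M = "ennreal M" and lam = \<mu> and c = "c / (u \<bullet> k)",
            OF I s Q F_meas F_supp F_total M' mu(1,2) side]) blast
    define z where "z = E Z"
    have zH: "z \<in> H" unfolding assms(6) z_def using k by (simp add: uE Zk)
    define P where "P = s_polar s (\<lambda>x. f (x + z))"
    have P_meas [measurable]: "P \<in> borel_measurable borel" unfolding P_def using s by (rule s_polar_measurable)
    have "ennreal M * (\<integral>\<^sup>+y. P (D y) \<partial>coords (insert k I)) \<le> ennreal (1 / (4 * \<mu> * (1 - \<mu>))) * (ball_const (insert k I) s)\<^sup>2"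
    proof (rule Z)
      show "(\<lambda>y. P (D y)) \<in> borel_measurable (coords (insert k I))"
        using measurable_compose[OF D_meas P_meas] unfolding BI .
      fix x y
      have "F (\<lambda>i\<in>insert k I. Z i + x i) * P (D y) = f' (E x + z) * P (D y)"
        unfolding F_def z_def E_add[symmetric] BI ..
      also have "\<dots> \<le> ennreal (f (E x + z)) * P (D y)"
        using f'[of "E x + z"] by (intro mult_right_mono) auto
      also have "\<dots> \<le> pos_powr s (1 - E x \<bullet> D y)"
        unfolding P_def by (rule mult_s_polar_le) (rule f0)
      finally show "F (\<lambda>i\<in>insert k I. Z i + x i) * P (D y) \<le> pos_powr s (1 - ip (insert k I) x y)"
        unfolding ED BI .
    qed
    also have "(\<integral>\<^sup>+y. P (D y) \<partial>coords (insert k I)) = (\<integral>\<^sup>+y. P y \<partial>lebesgue)"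
      using D_int[OF P_meas] unfolding BI by (simp add: nn_integral_completion)
    also have "ennreal (1 / (4 * \<mu> * (1 - \<mu>))) * (ball_const (insert k I) s)\<^sup>2 = ennreal (kappa\<^sup>2 / (4 * lam * (1 - lam)))"
    proof -
      have "kappa \<ge> 0" unfolding assms(11) set_lebesgue_integral_def by (rule Bochner_Integration.integral_nonneg) simp
      then show ?thesis
        unfolding mu(3) BI[symmetric] ball_const_Basis[OF s assms(11)] using lam
        by (simp add: power2_eq_square ennreal_mult[symmetric])
    qed
    finally show ?thesis using zH unfolding P_def M_def by blast
  qed
qed

end
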